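(* Let $D\subset\mathbb{C}$ be a domain, let $a\in\partial D$ be a $\mathcal{C}^2$-smooth boundary point of $D$, and let $m_D$ be any one of the functions $\gamma_D,\ \kappa_D,\ \beta_D/\sqrt{2},\ \sqrt{\pi K_D}$ on $D$. Then $$\lim_{z\to a,\ z\in D}\left(m_D(z)-\frac{1}{2d_D(z)}\right)=\frac{\chi_{\partial D}(a)}{4},$$ where $\chi_{\partial D}(a)$ is the signed curvature of $\partial D$ at $a$.
   Context: $\mathbb{D}$ is the open unit disc, $\mathcal{O}(X,Y)$ is the set of holomorphic maps from $X$ to $Y$, and $d_D(z)=\mathrm{dist}(z,\partial D)$. For a domain $D\subset\mathbb{C}$ and $z\in D$ (all metrics are evaluated at the tangent vector $1$): - Carathéodory metric: $\gamma_D(z)=\sup\{|f'(z)|: f\in\mathcal{O}(D,\mathbb{D}),\ f(z)=0\}$. - Kobayashi metric: $\kappa_D(z)=\inf\{|\alpha|:\exists\varphi\in\mathcal{O}(\mathbb{D},D)\text{ with }\varphi(0)=z,\ \alpha\varphi'(0)=1\}$. - Bergman kernel on the diagonal: $K_D(z)=\sup\{|f(z)|^2: f\in L^2_h(D),\ \|f\|_{L^2(D)}\le 1\}$, where $L^2_h(D)$ is the space of square-integrable (with respect to Lebesgue measure) holomorphic functions on $D$. - Bergman metric: $\beta_D(z)=M_D(z)/\sqrt{K_D(z)}$, where $M_D(z)=\sup\{|f'(z)|: f\in L^2_h(D),\ \|f\|_{L^2(D)}\le 1,\ f(z)=0\}$ (defined when $\mathbb{C}\setminus D$ is not polar, in which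 case $K_D>0$). A boundary point $a$ of $D$ is $\mathcal{C}^2$-smooth if $\partial D$ near $a$ is given by a $\mathcal{C}^2$ curve $\gamma:[0,1]\to\mathbb{C}$ with $\gamma'\neq 0$, with $D$ lying near $a$ on one side of this curve. The signed curvature is taken with respect to the inner normal, so that it is positive when $D$ is locally strictly convex (it is $1/r$ if $D$ is a disc of radius $r$, $-1/r$ if $D$ is the exterior of a closed disc of radius $r$, and $0$ for a half-plane). *)

theory Defs
  imports "HOL-Complex_Analysis.Complex_Analysis"
begin

definition caratheodory_metric :: "complex set \<Rightarrow> complex \<Rightarrow> real" where
  "caratheodory_metric D z =
     Sup {norm (deriv f z) | f. f holomorphic_on D \<and> f ` D \<subseteq> ball 0 1 \<and> f z = 0}"

definition kobayashi_metric :: "complex set \<Rightarrow> complex \<Rightarrow> real" where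
  "kobayashi_metric D z =
     Inf {norm \<alpha> | \<alpha> :: complex. \<exists>\<phi>. \<phi> holomorphic_on ball 0 1 \<and> \<phi> ` ball 0 1 \<subseteq> D \<and>
            \<phi> 0 = z \<and> \<alpha> * deriv \<phi> 0 = 1}"

definition L2h :: "complex set \<Rightarrow> (complex \<Rightarrow> complex) set" where
  "L2h D = {f. f holomorphic_on D \<and> set_integrable lborel D (\<lambda>w. (norm (f w))\<^sup>2)}"

definition L2_norm_on :: "complex set \<Rightarrow> (complex \<Rightarrow> complex) \<Rightarrow> real" where
  "L2_norm_on D f = sqrt (set_lebesgue_integral lborel D (\<lambda>w. (norm (f w))\<^sup>2))"

definition bergman_kernel :: "complex set \<Rightarrow> complex \<Rightarrow> real" where
  "bergman_kernel D z = Sup {(norm (f z))\<^sup>2 | f. f \<in> L2h D \<and> L2_norm_on D f \<le> 1}"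

definition bergman_M :: "complex set \<Rightarrow> complex \<Rightarrow> real" where
  "bergman_M D z = Sup {norm (deriv f z) | f. f \<in> L2h D \<and> L2_norm_on D f \<le> 1 \<and> f z = 0}"

definition bergman_metric :: "complex set \<Rightarrow> complex \<Rightarrow> real" where
  "bergman_metric D z = bergman_M D z / sqrt (bergman_kernel D z)"

definition boundary_dist :: "complex set \<Rightarrow> complex \<Rightarrow> real" where
  "boundary_dist D z = infdist z (frontier D)"

definition C2_regular_arc ::
  "(real \<Rightarrow> complex) \<Rightarrow> (real \<Rightarrow> complex) \<Rightarrow> (real \<Rightarrow> complex) \<Rightarrow> bool" where
  "C2_regular_arc g g' g'' \<longleftrightarrow>
     inj_on g {0..1} \<and>
     (\<forall>t\<in>{0..1}. (g has_vector_derivative g' t) (at t within {0..1}) \<and>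
                 (g' has_vector_derivative g'' t) (at t within {0..1}) \<and> g' t \<noteq> 0) \<and>
     continuous_on {0..1} g''"

text \<open>The unit normal of a curve with tangent vector \<open>v\<close>: to the left of the curve if
  \<open>\<sigma> = 1\<close>, to the right if \<open>\<sigma> = -1\<close>.\<close>

definition unit_normal :: "real \<Rightarrow> complex \<Rightarrow> complex" where
  "unit_normal \<sigma> v = of_real \<sigma> * \<i> * sgn v"

text \<open>Near \<open>a = g t0\<close> the boundary of \<open>D\<close> is the arc \<open>g\<close>, and \<open>D\<close> lies on exactly one side of
  it, namely the side selected by \<open>\<sigma>\<close>. The two sides are described in the
  coordinates \<open>(t, s) \<mapsto> g t + s n(t)\<close>, with \<open>n\<close> the unit normal, which for a regular arc of
  class \<open>C\<^sup>2\<close> parametrize a full neighbourhood of \<open>a\<close>.\<close>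

definition local_boundary_arc ::
  "complex set \<Rightarrow> complex \<Rightarrow> (real \<Rightarrow> complex) \<Rightarrow> (real \<Rightarrow> complex) \<Rightarrow> (real \<Rightarrow> complex) \<Rightarrow>
     real \<Rightarrow> real \<Rightarrow> bool" where
  "local_boundary_arc D a g g' g'' t0 \<sigma> \<longleftrightarrow>
     C2_regular_arc g g' g'' \<and> t0 \<in> {0<..<1} \<and> g t0 = a \<and> \<sigma> \<in> {1, -1} \<and>
     (\<exists>U. open U \<and> a \<in> U \<and> frontier D \<inter> U = g ` {0..1} \<inter> U) \<and>
     (\<exists>\<epsilon>>0. \<forall>t\<in>{0..1}. \<bar>t - t0\<bar> < \<epsilon> \<longrightarrow>
        (\<forall>s\<in>{0<..<\<epsilon>}. g t + of_real s * unit_normal \<sigma> (g' t) \<in> D \<and>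
                      g t - of_real s * unit_normal \<sigma> (g' t) \<notin> D))"

definition C2_smooth_boundary_point :: "complex set \<Rightarrow> complex \<Rightarrow> bool" where
  "C2_smooth_boundary_point D a \<longleftrightarrow>
     a \<in> frontier D \<and> (\<exists>g g' g'' t0 \<sigma>. local_boundary_arc D a g g' g'' t0 \<sigma>)"

text \<open>The component of the curvature vector along the inner unit normal; for a disc of
  radius \<open>r\<close> this is \<open>1/r\<close>. The value does not depend on the parametrization.\<close>

definition signed_curvature :: "complex set \<Rightarrow> complex \<Rightarrow> real" where
  "signed_curvature D a =
     (THE k. \<exists>g g' g'' t0 \<sigma>. local_boundary_arc D a g g' g'' t0 \<sigma> \<and>
             k = (g'' t0 \<bullet> unit_normal \<sigma> (g' t0)) / (norm (g' t0))\<^sup>2)"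

end

theory Submission
  imports Defs "HOL-Real_Asymp.Real_Asymp"
begin

text \<open>All four functions are squeezed between explicit quantities that depend only on the distance
  \<open>d\<close> to the boundary. Let \<open>F\<close> map \<open>D\<close> conformally into the disc with \<open>F z = 0\<close>, let \<open>\<phi>\<close> map the disc
  conformally into \<open>D\<close> with \<open>\<phi> 0 = z\<close>, and put \<open>A = \<bar>F' z\<bar>\<close>, \<open>B = 1 / \<bar>\<phi>' 0\<bar>\<close>. The Schwarz lemma places the
  Caratheodory and Kobayashi metrics in \<open>[A, B]\<close>. Comparing square-integrable functions on \<open>D\<close> with
  those on the disc gives \<open>A\<^sup>2 \<le> \<pi> K \<le> B\<^sup>2\<close> and \<open>\<surd>(2/\<pi>) A\<^sup>2 \<le> M \<le> \<surd>(2/\<pi>) B\<^sup>2\<close>. Hence all four lie in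
  \<open>[A\<^sup>2 / B, B\<^sup>2 / A]\<close> (\<open>invariant_metrics_between\<close>).

  For \<open>z\<close> near \<open>a\<close> let \<open>p\<close> be a nearest boundary point, so that \<open>z = p + d n\<close> with \<open>n\<close> the inner normal at
  \<open>p\<close>. Since the boundary is of class \<open>C\<^sup>2\<close>, within a distance of \<open>p\<close> independent of \<open>z\<close> it stays
  between the two circles tangent at \<open>p\<close> whose curvatures are slightly below and slightly above the
  curvature \<open>\<kappa>\<close> at \<open>a\<close> (\<open>local_arc_nearest_point\<close>). So \<open>D\<close> avoids a circular arc through \<open>p\<close> of curvature
  \<open>\<kappa> - 2 \<epsilon>\<close>, and contains a lune bounded by an arc of curvature \<open>\<kappa> + 2 \<epsilon>\<close> and an arc orthogonal to it. The
  complement of the arc and the lune are mapped onto a half-plane by Moebius maps followed by a square root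
  and a square, which gives \<open>F\<close> and \<open>\<phi>\<close> explicitly (\<open>outer_arc_map\<close>, \<open>inner_lune_map\<close>).
  Being local near \<open>p\<close>, both comparisons apply to an arbitrary domain.

  The resulting \<open>A\<close> and \<open>B\<close> are algebraic functions of \<open>d\<close> with expansion \<open>1 / (2 d) + c / 4 + O(d)\<close>, where
  \<open>c\<close> is the curvature of the arc in question; letting \<open>\<epsilon>\<close> tend to \<open>0\<close> proves the theorem for the curvature
  computed from any parametrization. Uniqueness of limits then shows that all parametrizations give
  the same curvature, so that \<open>signed_curvature\<close> is well defined.\<close>

section \<open>Conformal change of variables\<close>

text \<open>Gauge integrals on an open set are expressed as nonnegative integrals, so that the change of
  variables becomes an equality in \<open>[0, \<infinity>]\<close>, infinite values included.\<close>

lemma nn_integral_open_eq_integral: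
  fixes h :: "'a::euclidean_space \<Rightarrow> real"
  assumes T: "open T" and h: "continuous_on T h" and h0: "\<And>x. x \<in> T \<Longrightarrow> 0 \<le> h x"
  shows "(\<integral>\<^sup>+x. ennreal (h x) * indicator T x \<partial>lborel) =
         (if h absolutely_integrable_on T then ennreal (integral T h) else \<infinity>)"
proof -
  let ?h = "\<lambda>x. indicat_real T x *\<^sub>R h x"
  have meas: "?h \<in> borel_measurable lborel"
    using borel_measurable_continuous_on_indicator[OF _ h] T by simp
  have nn: "(\<integral>\<^sup>+x. ennreal (h x) * indicator T x \<partial>lborel) = (\<integral>\<^sup>+x. ennreal (?h x) \<partial>lborel)"
    by (intro nn_integral_cong) (auto simp: indicator_def)
  have pos: "AE x in lborel. 0 \<le> ?h x"
    using h0 by (auto simp: indicator_def)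
  have iff: "h absolutely_integrable_on T \<longleftrightarrow> integrable lborel ?h"
    unfolding set_integrable_def using integrable_completion[OF meas] by simp
  show ?thesis
  proof (cases "h absolutely_integrable_on T")
    case True
    then have "(\<integral>\<^sup>+x. ennreal (?h x) \<partial>lborel) = ennreal (integral\<^sup>L lborel ?h)"
      using iff pos by (intro nn_integral_eq_integral) auto
    also have "integral\<^sup>L lborel ?h = set_lebesgue_integral lebesgue T h"
      unfolding set_lebesgue_integral_def using integral_completion[OF meas] by simp
    also have "\<dots> = integral T h"
      using True by (rule set_lebesgue_integral_eq_integral)
    finally show ?thesis using True nn by simp
  next
    case False
    then have "\<not> integrable lborel ?h" using iff by simp
    then have "(\<integral>\<^sup>+x. ennreal (?h x) \<partial>lborel) = \<infinity>"
      using meas pos integrableI_nonneg[OF meas pos] by (cases "(\<integral>\<^sup>+x. ennreal (?h x) \<partial>lborel) = \<infinity>") (auto simp: less_top)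
    then show ?thesis using False nn by simp
  qed
qed

text \<open>The identification of \<open>\<complex>\<close> with \<open>\<real>\<^sup>2\<close>, where real
  Jacobian determinants make sense.\<close>

definition plane_to_complex :: "real^2 \<Rightarrow> complex" where
  "plane_to_complex x = Complex (x $ 1) (x $ 2)"

definition complex_to_plane :: "complex \<Rightarrow> real^2" where
  "complex_to_plane z = vector [Re z, Im z]"

lemma plane_complex_inverse [simp]:
  "plane_to_complex (complex_to_plane z) = z" "complex_to_plane (plane_to_complex x) = x"
  by (auto simp: plane_to_complex_def complex_to_plane_def vec_eq_iff forall_2)

lemma linear_plane_to_complex: "linear plane_to_complex"
  by (rule linearI) (auto simp: plane_to_complex_def complex_eq_iff)

lemma linear_complex_to_plane: "linear complex_to_plane"
  by (rule linearI) (auto simp: complex_to_plane_def vec_eq_iff forall_2)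

lemma bounded_linear_plane_to_complex: "bounded_linear plane_to_complex"
  by (simp add: linear_plane_to_complex linear_conv_bounded_linear[symmetric])

lemma bounded_linear_complex_to_plane: "bounded_linear complex_to_plane"
  by (simp add: linear_complex_to_plane linear_conv_bounded_linear[symmetric])

lemma lborel_complex_eq_distr: "(lborel :: complex measure) = distr lborel borel plane_to_complex"
proof (rule lborel_eqI)
  fix l u :: complex assume le: "\<And>b. b \<in> Basis \<Longrightarrow> l \<bullet> b \<le> u \<bullet> b"
  have [measurable]: "plane_to_complex \<in> borel_measurable borel"
    by (intro borel_measurable_continuous_onI linear_continuous_on bounded_linear_plane_to_complex)
  have "plane_to_complex -` box l u = box (complex_to_plane l) (complex_to_plane u)"
    by (auto simp: mem_box_cart plane_to_complex_def complex_to_plane_def forall_2 in_box_complex_iff)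
  then show "emeasure (distr lborel borel plane_to_complex) (box l u) = (\<Prod>b\<in>Basis. (u - l) \<bullet> b)"
    using le[of 1] le[of \<i>]
    by (simp add: emeasure_distr emeasure_lborel_box_eq Basis_vec_def Basis_complex_def UNION_singleton_eq_range
       complex_to_plane_def forall_2 inner_axis UNIV_2 axis_eq_axis)
qed simp

lemma change_of_variables_real_valued:
  fixes f :: "real^'m::{finite,wellorder} \<Rightarrow> real" and g :: "real^'m::_ \<Rightarrow> real^'m::_"
  assumes S: "S \<in> sets lebesgue"
    and der_g: "\<And>x. x \<in> S \<Longrightarrow> (g has_derivative g' x) (at x within S)"
    and inj: "inj_on g S"
  shows "(\<lambda>x. \<bar>det (matrix (g' x))\<bar> * f (g x)) absolutely_integrable_on S \<and>
           integral S (\<lambda>x. \<bar>det (matrix (g' x))\<bar> * f (g x)) = b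
     \<longleftrightarrow> f absolutely_integrable_on (g ` S) \<and> integral (g ` S) f = b"
proof -
  have "(\<lambda>x. \<bar>det (matrix (g' x))\<bar> *\<^sub>R vec (f (g x)) :: real ^ 1) absolutely_integrable_on S \<and>
           integral S (\<lambda>x. \<bar>det (matrix (g' x))\<bar> *\<^sub>R vec (f (g x))) = (vec b :: real ^ 1)
         \<longleftrightarrow> (\<lambda>x. vec (f x) :: real ^ 1) absolutely_integrable_on (g ` S) \<and>
           integral (g ` S) (\<lambda>x. vec (f x)) = (vec b :: real ^ 1)"
    using assms by (intro has_absolute_integral_change_of_variables) auto
  then show ?thesis
    by (simp add: absolutely_integrable_on_1_iff integral_on_1_eq)
qed

text \<open>The real Jacobian of multiplication by \<open>c\<close>: by the Cauchy-Riemann equations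
  this is the matrix of every complex derivative.\<close>

lemma det_complex_mult:
  "det (matrix (\<lambda>x. complex_to_plane (c * plane_to_complex x))) = (cmod c)\<^sup>2"
  by (simp add: det_2 matrix_def complex_to_plane_def plane_to_complex_def axis_def cmod_power2)
    (simp add: power2_eq_square)

text \<open>The transfer of the change of variables from \<open>\<real>\<^sup>2\<close> to \<open>\<complex>\<close>. It is what makes
  \<open>f \<mapsto> (f \<circ> \<phi>) \<phi>'\<close> an isometry of Bergman spaces.\<close>

lemma nn_integral_holomorphic_image:
  fixes f :: "complex \<Rightarrow> real"
  assumes S: "open S" and \<phi>: "\<phi> holomorphic_on S" "inj_on \<phi> S"
    and f: "continuous_on (\<phi> ` S) f" "\<And>w. w \<in> \<phi> ` S \<Longrightarrow> 0 \<le> f w"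
  shows "(\<integral>\<^sup>+w. ennreal (f w) * indicator (\<phi> ` S) w \<partial>lborel) =
         (\<integral>\<^sup>+z. ennreal ((cmod (deriv \<phi> z))\<^sup>2 * f (\<phi> z)) * indicator S z \<partial>lborel)"
proof -
  let ?e = plane_to_complex and ?i = complex_to_plane
  have e_meas [measurable]: "?e \<in> borel_measurable borel"
    by (intro borel_measurable_continuous_onI linear_continuous_on bounded_linear_plane_to_complex)
  have e_cont: "continuous_on X ?e" for X
    by (intro linear_continuous_on bounded_linear_plane_to_complex)
  have openimg: "open (\<phi> ` S)"
    using open_mapping_thm3[OF \<phi>(1) S \<phi>(2)] .
  have tr: "(\<integral>\<^sup>+w. ennreal (h w) * indicator T w \<partial>lborel) =
      (\<integral>\<^sup>+x. ennreal (h (?e x)) * indicator (?e -` T) x \<partial>lborel)"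
    if "open T" "continuous_on T h" "\<And>w. w \<in> T \<Longrightarrow> 0 \<le> h w" for h :: "complex \<Rightarrow> real" and T
  proof -
    have m: "(\<lambda>x. indicat_real T x *\<^sub>R h x) \<in> borel_measurable borel"
      using borel_measurable_continuous_on_indicator[OF _ that(2)] that(1) by simp
    have eq: "ennreal (h w) * indicator T w = ennreal (indicat_real T w *\<^sub>R h w)" for w
      by (auto simp: indicator_def)
    have "(\<integral>\<^sup>+w. ennreal (h w) * indicator T w \<partial>lborel) =
        (\<integral>\<^sup>+w. ennreal (indicat_real T w *\<^sub>R h w) \<partial>lborel)"
      unfolding eq ..
    also have "\<dots> = (\<integral>\<^sup>+x. ennreal (indicat_real T (?e x) *\<^sub>R h (?e x)) \<partial>lborel)"
      by (subst lborel_complex_eq_distr, subst nn_integral_distr) (use m in measurable)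
    also have "\<dots> = (\<integral>\<^sup>+x. ennreal (h (?e x)) * indicator (?e -` T) x \<partial>lborel)"
      unfolding eq[symmetric] by (intro nn_integral_cong) (auto simp: indicator_def)
    finally show ?thesis .
  qed
  let ?S = "?e -` S" and ?T = "?e -` (\<phi> ` S)"
  define G where "G = ?i \<circ> \<phi> \<circ> ?e"
  define J where "J = (\<lambda>z. (cmod (deriv \<phi> z))\<^sup>2 * f (\<phi> z))"
  have opS: "open ?S" "open ?T"
    using S openimg e_cont[of UNIV] by (auto intro: continuous_open_vimage simp: continuous_on_eq_continuous_at)
  have GS: "G ` ?S = ?T"
  proof -
    have "x \<in> G ` ?S" if "?e x = \<phi> z" "z \<in> S" for x z
      using that by (intro image_eqI[of _ _ "?i z"]) (auto simp: G_def simp flip: that(1))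
    then show ?thesis by (auto simp: G_def)
  qed
  have injG: "inj_on G ?S"
  proof (rule inj_onI)
    fix x y assume *: "x \<in> ?S" "y \<in> ?S" "G x = G y"
    then have "?e (G x) = ?e (G y)" by simp
    then have "\<phi> (?e x) = \<phi> (?e y)" by (simp add: G_def)
    with * have "?e x = ?e y" using \<phi>(2) by (auto dest: inj_onD)
    then have "?i (?e x) = ?i (?e y)" by simp
    then show "x = y" by simp
  qed
  have derG: "(G has_derivative (\<lambda>x. ?i (deriv \<phi> (?e x0) * ?e x))) (at x0 within ?S)" if "x0 \<in> ?S" for x0
  proof -
    have "(\<phi> has_field_derivative deriv \<phi> (?e x0)) (at (?e x0))"
      using \<phi>(1) S that by (auto intro: holomorphic_derivI)
    then have "(\<phi> has_derivative (*) (deriv \<phi> (?e x0))) (at (?e x0))"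
      by (simp add: has_field_derivative_def)
    then have "(G has_derivative (?i \<circ> ((*) (deriv \<phi> (?e x0)) \<circ> ?e))) (at x0)"
      unfolding G_def o_assoc[symmetric]
      by (intro diff_chain_at bounded_linear.has_derivative[OF bounded_linear_plane_to_complex]
          bounded_linear_imp_has_derivative bounded_linear_plane_to_complex bounded_linear_complex_to_plane) auto
    then show ?thesis by (simp add: o_def has_derivative_at_withinI)
  qed
  have cJ: "continuous_on S J"
    unfolding J_def
    by (intro continuous_intros holomorphic_on_imp_continuous_on[OF holomorphic_deriv[OF \<phi>(1) S]]
        continuous_on_compose2[OF f(1)] holomorphic_on_imp_continuous_on[OF \<phi>(1)]) auto
  have J0: "0 \<le> J z" if "z \<in> S" for z using f(2) that by (auto simp: J_def)
  have cov: "(\<lambda>x. J (?e x)) absolutely_integrable_on ?S \<and> integral ?S (\<lambda>x. J (?e x)) = b \<longleftrightarrow>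
      (\<lambda>x. f (?e x)) absolutely_integrable_on ?T \<and> integral ?T (\<lambda>x. f (?e x)) = b" for b
  proof -
    have "?S \<in> sets lebesgue" using opS by auto
    note cov' = change_of_variables_real_valued[OF this derG injG, of "\<lambda>x. f (?e x)" b]
    have "plane_to_complex (G x) = \<phi> (?e x)" for x by (simp add: G_def)
    with cov' show ?thesis by (simp add: det_complex_mult GS J_def)
  qed
  have "(\<integral>\<^sup>+w. ennreal (f w) * indicator (\<phi> ` S) w \<partial>lborel) =
        (\<integral>\<^sup>+x. ennreal (f (?e x)) * indicator ?T x \<partial>lborel)"
    using f openimg by (intro tr)
  also have "\<dots> = (if (\<lambda>x. f (?e x)) absolutely_integrable_on ?T
      then ennreal (integral ?T (\<lambda>x. f (?e x))) else \<infinity>)"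
    using f by (intro nn_integral_open_eq_integral opS continuous_on_compose2[OF f(1) e_cont]) auto
  also have "\<dots> = (if (\<lambda>x. J (?e x)) absolutely_integrable_on ?S
      then ennreal (integral ?S (\<lambda>x. J (?e x))) else \<infinity>)"
    using cov by metis
  also have "\<dots> = (\<integral>\<^sup>+x. ennreal (J (?e x)) * indicator ?S x \<partial>lborel)"
    using J0 by (intro nn_integral_open_eq_integral[symmetric] opS continuous_on_compose2[OF cJ e_cont]) auto
  also have "\<dots> = (\<integral>\<^sup>+z. ennreal (J z) * indicator S z \<partial>lborel)"
    using J0 cJ S by (intro tr[symmetric])
  finally show ?thesis by (simp add: J_def)
qed

section \<open>Square-integrable holomorphic functions on the disc\<close>

text \<open>Integrating the superlevel sets: \<open>{w. t \<le> \<bar>w\<bar>\<^sup>2}\<close> is an annulus of area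
  \<open>\<pi> - \<pi> t\<close>.\<close>

lemma nn_integral_disc_norm_square:
  "(\<integral>\<^sup>+w. ennreal ((cmod w)\<^sup>2) * indicator (ball 0 1) w \<partial>lborel) = ennreal (pi / 2)"
proof -
  have layer: "ennreal ((cmod w)\<^sup>2) * indicator (ball 0 1) w =
      (\<integral>\<^sup>+t. indicator {0..1} t * indicator {w'. w' \<in> ball 0 1 \<and> t \<le> (cmod w')\<^sup>2} w \<partial>lborel)" for w :: complex
  proof (cases "w \<in> ball 0 1")
    case True
    then have "(cmod w)\<^sup>2 \<le> 1" by (simp add: power_le_one)
    then have "(\<integral>\<^sup>+t. indicator {0..1} t * indicator {w'. w' \<in> ball 0 1 \<and> t \<le> (cmod w')\<^sup>2} w \<partial>lborel) =
       (\<integral>\<^sup>+t. indicator {0..(cmod w)\<^sup>2} t \<partial>lborel)"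
      using True by (intro nn_integral_cong) (auto simp: indicator_def)
    then show ?thesis using True by simp
  qed simp
  have meas: "emeasure lborel {w::complex. w \<in> ball 0 1 \<and> t \<le> (cmod w)\<^sup>2} = ennreal (pi - pi * t)"
    if "t \<in> {0..1}" for t
  proof -
    have "t \<le> (cmod w)\<^sup>2 \<longleftrightarrow> \<not> cmod w < sqrt t" for w :: complex
      using real_sqrt_le_iff[of t "(cmod w)\<^sup>2"] by (simp only: real_sqrt_abs abs_norm_cancel not_less)
    then have "{w::complex. w \<in> ball 0 1 \<and> t \<le> (cmod w)\<^sup>2} = ball 0 1 - ball 0 (sqrt t)"
      unfolding set_eq_iff Diff_iff mem_Collect_eq mem_ball_0 by blast
    also have "emeasure lborel \<dots> = emeasure lborel (ball (0::complex) 1) - emeasure lborel (ball (0::complex) (sqrt t))"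
      using that by (intro emeasure_Diff) (auto simp: emeasure_ball intro!: subset_ball)
    also have "\<dots> = ennreal (pi - pi * t)"
      using that by (simp add: emeasure_ball unit_ball_vol_2 ennreal_minus)
    finally show ?thesis .
  qed
  have m [measurable]: "Measurable.pred (lborel \<Otimes>\<^sub>M lborel)
      (\<lambda>(t::real, w::complex). w \<in> ball 0 1 \<and> t \<le> (cmod w)\<^sup>2)"
    unfolding mem_ball_0 by measurable
  have "(\<integral>\<^sup>+w. ennreal ((cmod w)\<^sup>2) * indicator (ball 0 1) w \<partial>lborel) =
     (\<integral>\<^sup>+w. (\<integral>\<^sup>+t. indicator {0..1} t * indicator {w'::complex. w' \<in> ball 0 1 \<and> t \<le> (cmod w')\<^sup>2} w \<partial>lborel) \<partial>lborel)"
    by (simp only: layer)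
  also have "\<dots> = (\<integral>\<^sup>+t. (\<integral>\<^sup>+w. indicator {0..1} t * indicator {w'::complex. w' \<in> ball 0 1 \<and> t \<le> (cmod w')\<^sup>2} w \<partial>lborel) \<partial>lborel)"
  proof (rule lborel_pair.Fubini')
    have eq: "indicator {w'::complex. w' \<in> ball 0 1 \<and> t \<le> (cmod w')\<^sup>2} w =
       (indicator {(t, w'::complex). w' \<in> ball 0 1 \<and> t \<le> (cmod w')\<^sup>2} (t, w) :: ennreal)" for w t
      by (auto simp: indicator_def)
    show "(\<lambda>(t, w::complex). indicator {0..1} t * indicator {w'. w' \<in> ball 0 1 \<and> t \<le> (cmod w')\<^sup>2} w :: ennreal)
       \<in> borel_measurable (lborel \<Otimes>\<^sub>M lborel)"
      unfolding eq using m by measurable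
  qed
  also have "\<dots> = (\<integral>\<^sup>+t. indicator {0..1} t * emeasure lborel {w::complex. w \<in> ball 0 1 \<and> t \<le> (cmod w)\<^sup>2} \<partial>lborel)"
    by (intro nn_integral_cong) (simp add: nn_integral_cmult)
  also have "\<dots> = (\<integral>\<^sup>+t. ennreal (pi - pi * t) * indicator {0..1} t \<partial>lborel)"
    by (intro nn_integral_cong) (auto simp: indicator_def meas[unfolded mem_ball_0])
  also have "\<dots> = ennreal ((pi * 1 - pi * 1\<^sup>2 / 2) - (pi * 0 - pi * 0\<^sup>2 / 2))"
    by (intro nn_integral_FTC_Icc) (auto intro!: derivative_eq_intros simp: field_simps)
  finally show ?thesis by simp
qed

text \<open>The mean value property of the holomorphic function \<open>\<xi> \<mapsto> k(\<xi> w)\<^sup>2\<close> on the unit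
  circle, followed by the triangle inequality for integrals.\<close>

lemma norm_square_le_circle_mean:
  fixes k :: "complex \<Rightarrow> complex"
  assumes k: "k holomorphic_on ball 0 1" and w: "w \<in> ball 0 1"
  shows "ennreal (2 * pi * (cmod (k 0))\<^sup>2) \<le>
    (\<integral>\<^sup>+t. ennreal ((cmod (k (cis t * w)))\<^sup>2) * indicator {0..2 * pi} t \<partial>lborel)"
proof -
  define G where "G = (\<lambda>\<xi>. (k (\<xi> * w))\<^sup>2)"
  have in_ball: "\<xi> * w \<in> ball 0 1" if "cmod \<xi> \<le> 1" for \<xi>
    using that w by (simp add: norm_mult) (metis le_less_trans mult_left_le_one_le norm_ge_zero)
  have holG: "G holomorphic_on cball 0 1"
    unfolding G_def using in_ball
    by (auto intro!: holomorphic_intros holomorphic_on_compose_gen[OF _ k, unfolded o_def])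
  have "((\<lambda>u. G u / (u - 0)) has_contour_integral (2 * of_real pi * \<i> * G 0)) (circlepath 0 1)"
    by (rule Cauchy_integral_circlepath_simple[OF holG]) simp
  then have "((\<lambda>t. G (cis t) * \<i>) has_integral (2 * of_real pi * \<i> * G 0)) {0..2 * pi}"
    unfolding circlepath_def by (subst (asm) has_contour_integral_part_circlepath_iff) auto
  then have I: "integral {0..2 * pi} (\<lambda>t. G (cis t) * \<i>) = 2 * of_real pi * \<i> * G 0"
    by (rule integral_unique)
  have cont: "continuous_on {0..2 * pi} (\<lambda>t. G (cis t))"
    by (intro continuous_on_compose2[OF holomorphic_on_imp_continuous_on[OF holG]] continuous_intros) auto
  have "2 * pi * (cmod (k 0))\<^sup>2 = cmod (2 * of_real pi * \<i> * G 0)"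
    by (simp add: norm_mult norm_power G_def)
  also have "\<dots> = cmod (integral {0..2 * pi} (\<lambda>t. G (cis t) * \<i>))"
    by (simp only: I)
  also have "\<dots> \<le> integral {0..2 * pi} (\<lambda>t. cmod (G (cis t)))"
    using cont by (intro integral_norm_bound_integral integrable_continuous_real continuous_intros)
      (auto simp: norm_mult)
  finally have le: "2 * pi * (cmod (k 0))\<^sup>2 \<le> integral {0..2 * pi} (\<lambda>t. cmod (G (cis t)))" .
  have "((\<lambda>t. cmod (G (cis t))) has_integral integral {0..2 * pi} (\<lambda>t. cmod (G (cis t)))) {0..2 * pi}"
    using cont by (intro integrable_integral integrable_continuous_real continuous_intros)
  then have "(\<integral>\<^sup>+t. ennreal (cmod (G (cis t))) * indicator {0..2 * pi} t \<partial>lborel) =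
      ennreal (integral {0..2 * pi} (\<lambda>t. cmod (G (cis t))))"
    by (intro nn_integral_has_integral_lebesgue') auto
  with le show ?thesis by (simp add: G_def norm_power ennreal_leI)
qed

text \<open>The sharp estimate of a Taylor coefficient by the \<open>L\<^sup>2\<close> norm. Averaging over rotations
  replaces \<open>\<bar>k\<bar>\<^sup>2\<close> by its circle means, which are at least \<open>\<bar>k 0\<bar>\<^sup>2\<close>; Tonelli and the rotation
  invariance of area do the rest. The case \<open>m = 0\<close> bounds \<open>h 0\<close> and is used for the Bergman kernel;
  \<open>m = 1\<close> bounds \<open>h' 0\<close> when \<open>h 0 = 0\<close> and is used for the Bergman metric.\<close>

lemma nn_integral_disc_ge_center:
  fixes h k :: "complex \<Rightarrow> complex"
  assumes h: "h holomorphic_on ball 0 1" and k: "k holomorphic_on ball 0 1"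
    and hk: "\<And>w. w \<in> ball 0 1 \<Longrightarrow> h w = w ^ m * k w"
  shows "ennreal ((cmod (k 0))\<^sup>2) * (\<integral>\<^sup>+w. ennreal ((cmod w) ^ (2 * m)) * indicator (ball 0 1) w \<partial>lborel)
     \<le> (\<integral>\<^sup>+w. ennreal ((cmod (h w))\<^sup>2) * indicator (ball 0 1) w \<partial>lborel)"
proof -
  let ?B = "ball (0::complex) 1"
  define h0 where "h0 = (\<lambda>w. indicat_real ?B w *\<^sub>R (cmod (h w))\<^sup>2)"
  have h0_meas [measurable]: "h0 \<in> borel_measurable borel"
    unfolding h0_def
    by (intro borel_measurable_continuous_on_indicator continuous_intros holomorphic_on_imp_continuous_on h) auto
  have h0_eq: "ennreal (h0 w) = ennreal ((cmod (h w))\<^sup>2) * indicator ?B w" for w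
    by (auto simp: h0_def indicator_def)
  have rot: "(\<integral>\<^sup>+w. ennreal (h0 (cis t * w)) \<partial>lborel) = (\<integral>\<^sup>+w. ennreal (h0 w) \<partial>lborel)" for t
  proof -
    have img: "(*) (cis t) ` ?B = ?B"
    proof -
      have "w \<in> (*) (cis t) ` ?B" if "w \<in> ?B" for w
        using that by (intro image_eqI[of _ _ "cis (- t) * w"]) (auto simp: norm_mult cis_mult simp flip: mult.assoc)
      then show ?thesis by (auto simp: norm_mult)
    qed
    have d: "deriv ((*) (cis t)) z = cis t" for z
      by (auto intro!: DERIV_imp_deriv derivative_eq_intros)
    have "(\<integral>\<^sup>+w. ennreal ((cmod (h w))\<^sup>2) * indicator ((*) (cis t) ` ?B) w \<partial>lborel) =
       (\<integral>\<^sup>+z. ennreal ((cmod (deriv ((*) (cis t)) z))\<^sup>2 * (cmod (h (cis t * z)))\<^sup>2) * indicator ?B z \<partial>lborel)"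
      by (intro nn_integral_holomorphic_image)
        (auto simp: img inj_on_def intro!: holomorphic_intros continuous_intros holomorphic_on_imp_continuous_on h)
    also have "\<dots> = (\<integral>\<^sup>+w. ennreal (h0 (cis t * w)) \<partial>lborel)"
      unfolding h0_eq by (intro nn_integral_cong) (auto simp: d norm_mult indicator_def)
    finally show ?thesis by (simp add: h0_eq img)
  qed
  have [measurable]: "(\<lambda>w. ennreal ((cmod w) ^ (2 * m)) * indicator ?B w) \<in> borel_measurable borel"
    by (intro borel_measurable_times_ennreal measurable_compose[OF _ measurable_ennreal]
        borel_measurable_indicator borel_measurable_continuous_onI continuous_intros) simp
  have pi2: "ennreal (2 * (pi * x)) = ennreal (2 * pi) * ennreal x" for x
    by (simp add: mult.assoc flip: ennreal_mult')
  have "ennreal (2 * pi) * (ennreal ((cmod (k 0))\<^sup>2) * (\<integral>\<^sup>+w. ennreal ((cmod w) ^ (2 * m)) * indicator ?B w \<partial>lborel))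
     = (\<integral>\<^sup>+w. ennreal (2 * pi * (cmod (k 0))\<^sup>2) * (ennreal ((cmod w) ^ (2 * m)) * indicator ?B w) \<partial>lborel)"
    by (subst nn_integral_cmult) (simp_all only: pi2 mult.assoc, simp)
  also have "\<dots> \<le> (\<integral>\<^sup>+w. (\<integral>\<^sup>+t. ennreal (h0 (cis t * w)) * indicator {0..2 * pi} t \<partial>lborel) \<partial>lborel)"
  proof (rule nn_integral_mono)
    fix w :: complex
    show "ennreal (2 * pi * (cmod (k 0))\<^sup>2) * (ennreal ((cmod w) ^ (2 * m)) * indicator ?B w) \<le>
      (\<integral>\<^sup>+t. ennreal (h0 (cis t * w)) * indicator {0..2 * pi} t \<partial>lborel)"
    proof (cases "w \<in> ?B")
      case True
      have hw: "h0 (cis t * w) = (cmod w) ^ (2 * m) * (cmod (k (cis t * w)))\<^sup>2" for t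
        using True hk[of "cis t * w"] by (auto simp: h0_def norm_mult norm_power power_mult_distrib power_mult mult.commute[of 2 m])
      have kc: "continuous_on UNIV (\<lambda>t. k (cis t * w))"
        using True by (intro continuous_on_compose2[OF holomorphic_on_imp_continuous_on[OF k]] continuous_intros)
          (auto simp: norm_mult)
      have [measurable]: "(\<lambda>t. ennreal ((cmod (k (cis t * w)))\<^sup>2)) \<in> borel_measurable borel"
        using borel_measurable_continuous_onI[OF kc] by measurable
      have "ennreal (2 * pi * (cmod (k 0))\<^sup>2) * (ennreal ((cmod w) ^ (2 * m)) * indicator ?B w) =
         ennreal ((cmod w) ^ (2 * m)) * ennreal (2 * pi * (cmod (k 0))\<^sup>2)"
        using True by (simp add: mult.commute)
      also have "\<dots> \<le> ennreal ((cmod w) ^ (2 * m)) *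
          (\<integral>\<^sup>+t. ennreal ((cmod (k (cis t * w)))\<^sup>2) * indicator {0..2 * pi} t \<partial>lborel)"
        by (intro mult_left_mono norm_square_le_circle_mean k True) simp
      also have "\<dots> = (\<integral>\<^sup>+t. ennreal (h0 (cis t * w)) * indicator {0..2 * pi} t \<partial>lborel)"
        by (subst nn_integral_cmult[symmetric]) (auto simp: hw ennreal_mult' mult.assoc)
      finally show ?thesis .
    qed simp
  qed
  also have "\<dots> = (\<integral>\<^sup>+t. (\<integral>\<^sup>+w. ennreal (h0 (cis t * w)) * indicator {0..2 * pi} t \<partial>lborel) \<partial>lborel)"
  proof (rule lborel_pair.Fubini')
    have [measurable]: "cis \<in> borel_measurable borel"
      by (intro borel_measurable_continuous_onI continuous_intros)
    show "(\<lambda>(t, w). ennreal (h0 (cis t * w)) * indicator {0..2 * pi} t) \<in> borel_measurable (lborel \<Otimes>\<^sub>M lborel)"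
      by measurable
  qed
  also have "\<dots> = (\<integral>\<^sup>+t. (\<integral>\<^sup>+w. ennreal (h0 w) \<partial>lborel) * indicator {0..2 * pi} t \<partial>lborel)"
    by (intro nn_integral_cong) (auto simp: indicator_def rot)
  also have "\<dots> = ennreal (2 * pi) * (\<integral>\<^sup>+w. ennreal (h0 w) \<partial>lborel)"
    by (subst nn_integral_cmult) (auto simp: mult.commute)
  finally show ?thesis
    by (subst (asm) ennreal_mult_le_mult_iff) (auto simp: h0_eq)
qed

section \<open>Extremal problems between two conformal maps\<close>

lemma L2h_unit_ball_iff:
  assumes D: "open D" and f: "f holomorphic_on D"
  shows "f \<in> L2h D \<and> L2_norm_on D f \<le> 1 \<longleftrightarrow>
    (\<integral>\<^sup>+w. ennreal ((cmod (f w))\<^sup>2) * indicator D w \<partial>lborel) \<le> 1"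
proof -
  let ?h = "\<lambda>w. indicat_real D w *\<^sub>R (cmod (f w))\<^sup>2"
  have m: "?h \<in> borel_measurable lborel"
    using borel_measurable_continuous_on_indicator[of D "\<lambda>w. (cmod (f w))\<^sup>2"] D
    by (simp add: continuous_intros holomorphic_on_imp_continuous_on[OF f])
  have nn: "(\<integral>\<^sup>+w. ennreal ((cmod (f w))\<^sup>2) * indicator D w \<partial>lborel) = (\<integral>\<^sup>+w. ennreal (?h w) \<partial>lborel)"
    by (intro nn_integral_cong) (auto simp: indicator_def)
  have pos: "AE w in lborel. 0 \<le> ?h w" by simp
  have eq: "(\<integral>\<^sup>+w. ennreal (?h w) \<partial>lborel) = ennreal (integral\<^sup>L lborel ?h)" if "integrable lborel ?h"
    using that pos by (rule nn_integral_eq_integral)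
  have int: "integrable lborel ?h" if "(\<integral>\<^sup>+w. ennreal (?h w) \<partial>lborel) \<le> 1"
    using m pos by (rule integrableI_nonneg) (use that in \<open>auto intro: le_less_trans\<close>)
  show ?thesis
    using eq int f unfolding nn L2h_def L2_norm_on_def set_integrable_def set_lebesgue_integral_def
    by (auto simp: ennreal_le_1)
qed

lemma disc_L2_bound:
  assumes D: "open D" and \<phi>: "\<phi> holomorphic_on ball 0 1" "inj_on \<phi> (ball 0 1)" "\<phi> ` ball 0 1 \<subseteq> D"
    and f: "f \<in> L2h D" "L2_norm_on D f \<le> 1"
  shows "(\<integral>\<^sup>+w. ennreal ((cmod (f (\<phi> w) * deriv \<phi> w))\<^sup>2) * indicator (ball 0 1) w \<partial>lborel) \<le> 1"
proof -
  have fh: "f holomorphic_on D" using f by (simp add: L2h_def)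
  have "(\<integral>\<^sup>+w. ennreal ((cmod (f (\<phi> w) * deriv \<phi> w))\<^sup>2) * indicator (ball 0 1) w \<partial>lborel) =
    (\<integral>\<^sup>+w. ennreal ((cmod (f w))\<^sup>2) * indicator (\<phi> ` ball 0 1) w \<partial>lborel)"
    by (subst nn_integral_holomorphic_image)
      (use \<phi> in \<open>auto intro!: continuous_intros holomorphic_on_imp_continuous_on[OF holomorphic_on_subset[OF fh]]
         simp: norm_mult power_mult_distrib mult.commute\<close>)
  also have "\<dots> \<le> (\<integral>\<^sup>+w. ennreal ((cmod (f w))\<^sup>2) * indicator D w \<partial>lborel)"
    using \<phi>(3) by (intro nn_integral_mono) (auto simp: indicator_def)
  also have "\<dots> \<le> 1"
    using L2h_unit_ball_iff[OF D fh] f by blast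
  finally show ?thesis .
qed

lemma cmod_square_le_of_ennreal:
  assumes "ennreal ((cmod a)\<^sup>2) * ennreal c \<le> 1" and "c > 0"
  shows "(cmod a)\<^sup>2 \<le> 1 / c"
  using assms by (simp add: ennreal_mult'[symmetric] ennreal_le_1 field_simps)

text \<open>The Schwarz lemma for \<open>f \<circ> \<psi>\<close>; it gives both the upper bound for the Caratheodory
  metric and the lower bound for the Kobayashi metric.\<close>

lemma schwarz_composition:
  assumes D: "open D" and z: "z \<in> D"
    and f: "f holomorphic_on D" "f ` D \<subseteq> ball 0 1" "f z = 0"
    and \<psi>: "\<psi> holomorphic_on ball 0 1" "\<psi> ` ball 0 1 \<subseteq> D" "\<psi> 0 = z"
  shows "cmod (deriv f z) * cmod (deriv \<psi> 0) \<le> 1"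
proof -
  have "deriv (f \<circ> \<psi>) 0 = deriv f z * deriv \<psi> 0"
    using holomorphic_on_imp_differentiable_at[OF f(1) D z]
      holomorphic_on_imp_differentiable_at[OF \<psi>(1) open_ball, of 0] \<psi>(3)
    by (subst deriv_chain) auto
  moreover have "norm (deriv (f \<circ> \<psi>) 0) \<le> 1"
  proof (rule Schwarz_Lemma(2)[of _ 0])
    show "(f \<circ> \<psi>) holomorphic_on ball 0 1"
      using f \<psi> by (intro holomorphic_on_compose_gen)
  qed (use f \<psi> in \<open>auto simp: image_subset_iff\<close>)
  ultimately show ?thesis by (simp add: norm_mult)
qed

text \<open>A conformal map \<open>F\<close> of \<open>D\<close> into the disc and a conformal map \<open>\<phi>\<close> of the disc into \<open>D\<close>,
  both normalized at \<open>z\<close>, control the extremal problems at \<open>z\<close>: \<open>F\<close> supplies competitors and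
  \<open>\<phi>\<close> pulls competitors back to the disc, where the extremal values are known.\<close>

context
  fixes D :: "complex set" and z :: complex and F \<phi> :: "complex \<Rightarrow> complex" and A B :: real
  assumes D: "open D" and z: "z \<in> D"
    and F: "F holomorphic_on D" "inj_on F D" "F ` D \<subseteq> ball 0 1" "F z = 0"
    and \<phi>: "\<phi> holomorphic_on ball 0 1" "inj_on \<phi> (ball 0 1)" "\<phi> ` ball 0 1 \<subseteq> D" "\<phi> 0 = z"
    and A: "A = cmod (deriv F z)" and B: "B = 1 / cmod (deriv \<phi> 0)"
begin

lemma \<phi>_deriv: "(\<phi> has_field_derivative deriv \<phi> 0) (at 0)"
  by (rule holomorphic_derivI[OF \<phi>(1)]) auto

lemma lower_rate_pos: "0 < A"
  using holomorphic_injective_imp_regular[OF F(1) D F(2) z] by (simp add: A)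

lemma \<phi>_deriv_nonzero: "deriv \<phi> 0 \<noteq> 0"
  using holomorphic_injective_imp_regular[OF \<phi>(1) open_ball \<phi>(2)] by simp

lemma upper_rate_pos: "0 < B"
  using \<phi>_deriv_nonzero by (simp add: B)

lemma caratheodory_metric_between: "A \<le> caratheodory_metric D z" "caratheodory_metric D z \<le> B"
proof -
  let ?X = "{norm (deriv f z) | f. f holomorphic_on D \<and> f ` D \<subseteq> ball 0 1 \<and> f z = 0}"
  have ub: "x \<le> B" if "x \<in> ?X" for x
    using that schwarz_composition[OF D z _ _ _ \<phi>(1,3,4)] \<phi>_deriv_nonzero by (auto simp: B field_simps)
  have mem: "A \<in> ?X" using F A by blast
  show "A \<le> caratheodory_metric D z"
    unfolding caratheodory_metric_def using mem ub by (intro cSup_upper bdd_aboveI)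
  show "caratheodory_metric D z \<le> B"
    unfolding caratheodory_metric_def using mem ub by (intro cSup_least) auto
qed

lemma kobayashi_metric_between: "A \<le> kobayashi_metric D z" "kobayashi_metric D z \<le> B"
proof -
  let ?X = "{norm \<alpha> | \<alpha> :: complex. \<exists>\<phi>. \<phi> holomorphic_on ball 0 1 \<and> \<phi> ` ball 0 1 \<subseteq> D \<and>
            \<phi> 0 = z \<and> \<alpha> * deriv \<phi> 0 = 1}"
  have lb: "A \<le> x" if x0: "x \<in> ?X" for x
  proof -
    obtain \<alpha> \<psi> where x: "x = norm \<alpha>" and \<psi>: "\<psi> holomorphic_on ball 0 1" "\<psi> ` ball 0 1 \<subseteq> D"
        "\<psi> 0 = z" and \<alpha>: "\<alpha> * deriv \<psi> 0 = 1"
      using x0 by blast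
    have "cmod \<alpha> * cmod (deriv \<psi> 0) = 1"
      using \<alpha> by (metis norm_mult norm_one)
    moreover from this have "0 < cmod (deriv \<psi> 0)"
      by (metis mult_zero_right norm_ge_zero order_le_less zero_neq_one)
    moreover have "A * cmod (deriv \<psi> 0) \<le> 1"
      using schwarz_composition[OF D z F(1,3,4) \<psi>] by (simp add: A)
    ultimately show ?thesis
      unfolding x by (metis mult_le_cancel_right_pos)
  qed
  have mem: "B \<in> ?X"
    using \<phi> \<phi>_deriv_nonzero by (auto intro!: exI[of _ "1 / deriv \<phi> 0"] exI[of _ \<phi>] simp: B norm_divide)
  show "A \<le> kobayashi_metric D z"
    unfolding kobayashi_metric_def using mem lb by (intro cInf_greatest) auto
  show "kobayashi_metric D z \<le> B"
    unfolding kobayashi_metric_def using mem lb by (intro cInf_lower bdd_belowI)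
qed

lemma deriv_F_holomorphic: "deriv F holomorphic_on D"
  using F D by (intro holomorphic_deriv)

text \<open>The competitor is \<open>F' / \<surd>\<pi>\<close>, whose squared norm is the area of \<open>F(D)\<close> divided by \<open>\<pi>\<close>.\<close>

lemma bergman_kernel_between: "A\<^sup>2 \<le> pi * bergman_kernel D z" "pi * bergman_kernel D z \<le> B\<^sup>2"
proof -
  let ?X = "{(norm (f z))\<^sup>2 | f. f \<in> L2h D \<and> L2_norm_on D f \<le> 1}"
  have ub: "x \<le> B\<^sup>2 / pi" if x: "x \<in> ?X" for x
  proof -
    obtain f where x: "x = (norm (f z))\<^sup>2" and f: "f \<in> L2h D" "L2_norm_on D f \<le> 1"
      using x by blast
    let ?h = "\<lambda>w. f (\<phi> w) * deriv \<phi> w"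
    have "?h holomorphic_on ball 0 1"
      using f(1) \<phi> by (auto simp: L2h_def intro!: holomorphic_intros holomorphic_on_compose_gen[of \<phi> _ f, unfolded o_def])
    from nn_integral_disc_ge_center[OF this this, of 0]
    have "ennreal ((cmod (?h 0))\<^sup>2) * ennreal pi \<le> 1"
      using disc_L2_bound[OF D \<phi>(1-3) f]
      by (simp add: emeasure_ball unit_ball_vol_2)
    then have "(cmod (?h 0))\<^sup>2 \<le> 1 / pi"
      by (rule cmod_square_le_of_ennreal) simp
    then show ?thesis using \<phi>_deriv_nonzero
      by (simp add: x B \<phi>(4) norm_mult power_mult_distrib field_simps)
  qed
  let ?f = "\<lambda>w. deriv F w / sqrt pi"
  have fh: "?f holomorphic_on D" by (intro holomorphic_intros deriv_F_holomorphic) auto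
  have "(\<integral>\<^sup>+w. ennreal ((cmod (?f w))\<^sup>2) * indicator D w \<partial>lborel) =
     (\<integral>\<^sup>+w. ennreal ((cmod (deriv F w))\<^sup>2 * (1 / pi)) * indicator D w \<partial>lborel)"
    by (simp add: norm_divide power_divide)
  also have "\<dots> = (\<integral>\<^sup>+w. ennreal (1 / pi) * indicator (F ` D) w \<partial>lborel)"
    using F D by (intro nn_integral_holomorphic_image[symmetric]) auto
  also have "\<dots> \<le> (\<integral>\<^sup>+w. ennreal (1 / pi) * indicator (ball (0::complex) 1) w \<partial>lborel)"
    using F(3) by (intro nn_integral_mono) (auto simp: indicator_def)
  also have "\<dots> = 1"
    by (simp add: nn_integral_cmult_indicator emeasure_ball unit_ball_vol_2 flip: ennreal_mult')
  finally have "?f \<in> L2h D \<and> L2_norm_on D ?f \<le> 1"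
    using L2h_unit_ball_iff[OF D fh] by blast
  then have "(norm (?f z))\<^sup>2 \<in> ?X" by (intro CollectI exI[of _ ?f] conjI) auto
  moreover have "(norm (?f z))\<^sup>2 = A\<^sup>2 / pi"
    by (simp add: A norm_divide power_divide)
  ultimately have mem: "A\<^sup>2 / pi \<in> ?X" by metis
  have "A\<^sup>2 / pi \<le> bergman_kernel D z"
    unfolding bergman_kernel_def using mem ub by (intro cSup_upper bdd_aboveI)
  then show "A\<^sup>2 \<le> pi * bergman_kernel D z" by (simp add: field_simps)
  have "bergman_kernel D z \<le> B\<^sup>2 / pi"
    unfolding bergman_kernel_def using mem ub by (intro cSup_least) auto
  then show "pi * bergman_kernel D z \<le> B\<^sup>2" by (simp add: field_simps)
qed

text \<open>The competitor is a multiple of \<open>F F'\<close>, whose squared norm is the integral of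
  \<open>\<bar>w\<bar>\<^sup>2\<close> over \<open>F(D)\<close>; over the disc this integral is \<open>\<pi> / 2\<close>.\<close>

lemma bergman_M_between:
  "sqrt (2 / pi) * A\<^sup>2 \<le> bergman_M D z" "bergman_M D z \<le> sqrt (2 / pi) * B\<^sup>2"
proof -
  let ?X = "{norm (deriv f z) | f. f \<in> L2h D \<and> L2_norm_on D f \<le> 1 \<and> f z = 0}"
  have ub: "x \<le> sqrt (2 / pi) * B\<^sup>2" if x: "x \<in> ?X" for x
  proof -
    obtain f where x: "x = norm (deriv f z)" and f: "f \<in> L2h D" "L2_norm_on D f \<le> 1" and f0: "f z = 0"
      using x by blast
    have fh: "f holomorphic_on D" using f by (simp add: L2h_def)
    let ?h = "\<lambda>w. f (\<phi> w) * deriv \<phi> w"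
    have hh: "?h holomorphic_on ball 0 1"
      using fh \<phi> by (auto intro!: holomorphic_intros holomorphic_on_compose_gen[of \<phi> _ f, unfolded o_def])
    have "?h 0 = 0" by (simp add: f0 \<phi>(4))
    from Schwarz3[OF hh this] obtain k where k: "k holomorphic_on ball 0 1"
        "\<And>w. norm w < 1 \<Longrightarrow> ?h w = w * k w" "deriv ?h 0 = k 0" by metis
    have "(deriv \<phi> has_field_derivative deriv (deriv \<phi>) 0) (at 0)"
      by (rule holomorphic_derivI[of _ "ball 0 1"]) (auto intro: holomorphic_deriv \<phi>)
    moreover have "((f \<circ> \<phi>) has_field_derivative deriv f z * deriv \<phi> 0) (at 0)"
      using fh D z by (intro DERIV_chain \<phi>_deriv) (auto simp: \<phi>(4) intro: holomorphic_derivI)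
    ultimately have "(?h has_field_derivative (deriv f z * deriv \<phi> 0 * deriv \<phi> 0)) (at 0)"
      by (auto intro!: derivative_eq_intros simp: f0 \<phi>(4) o_def)
    then have k0: "k 0 = deriv f z * deriv \<phi> 0 * deriv \<phi> 0"
      using k(3) DERIV_imp_deriv by metis
    have "ennreal ((cmod (k 0))\<^sup>2) * ennreal (pi / 2) \<le> 1"
      using nn_integral_disc_ge_center[OF hh k(1), of 1] k(2) disc_L2_bound[OF D \<phi>(1-3) f]
      by (simp add: nn_integral_disc_norm_square)
    then have "(cmod (k 0))\<^sup>2 \<le> 1 / (pi / 2)"
      by (rule cmod_square_le_of_ennreal) simp
    then have "cmod (k 0) \<le> sqrt (2 / pi)"
      by (simp add: real_le_rsqrt)
    then show ?thesis using \<phi>_deriv_nonzero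
      by (simp add: x B k0 norm_mult power_divide field_simps power2_eq_square)
  qed
  define c where "c = sqrt (2 / pi)"
  have c: "c\<^sup>2 = 2 / pi" "0 < c" by (auto simp: c_def)
  let ?f = "\<lambda>w. of_real c * F w * deriv F w"
  have fh: "?f holomorphic_on D" by (intro holomorphic_intros deriv_F_holomorphic F)
  have "(\<integral>\<^sup>+w. ennreal ((cmod (?f w))\<^sup>2) * indicator D w \<partial>lborel) =
     (\<integral>\<^sup>+w. ennreal ((cmod (deriv F w))\<^sup>2 * (c\<^sup>2 * (cmod (F w))\<^sup>2)) * indicator D w \<partial>lborel)"
    by (simp add: norm_mult power_mult_distrib ac_simps)
  also have "\<dots> = (\<integral>\<^sup>+w. ennreal (c\<^sup>2 * (cmod w)\<^sup>2) * indicator (F ` D) w \<partial>lborel)"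
    using F D by (intro nn_integral_holomorphic_image[symmetric]) (auto intro!: continuous_intros)
  also have "\<dots> \<le> (\<integral>\<^sup>+w. ennreal (c\<^sup>2) * (ennreal ((cmod w)\<^sup>2) * indicator (ball (0::complex) 1) w) \<partial>lborel)"
    using F(3) by (intro nn_integral_mono) (auto simp: indicator_def ennreal_mult)
  also have "\<dots> = ennreal (c\<^sup>2) * ennreal (pi / 2)"
    by (subst nn_integral_cmult) (auto simp: nn_integral_disc_norm_square intro!: borel_measurable_times_ennreal borel_measurable_indicator)
  also have "\<dots> = 1" by (simp add: c flip: ennreal_mult')
  finally have "?f \<in> L2h D \<and> L2_norm_on D ?f \<le> 1"
    using L2h_unit_ball_iff[OF D fh] by blast
  then have "norm (deriv ?f z) \<in> ?X" using F(4) by auto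
  moreover have "norm (deriv ?f z) = c * A\<^sup>2"
  proof -
    have "(F has_field_derivative deriv F z) (at z)" "(deriv F has_field_derivative deriv (deriv F) z) (at z)"
      using F(1) deriv_F_holomorphic D z by (auto intro: holomorphic_derivI)
    then have "(?f has_field_derivative of_real c * deriv F z * deriv F z) (at z)"
      by (auto intro!: derivative_eq_intros simp: F(4))
    then have "deriv ?f z = of_real c * deriv F z * deriv F z"
      by (rule DERIV_imp_deriv)
    then show ?thesis using c by (simp add: A norm_mult power2_eq_square)
  qed
  ultimately have mem: "sqrt (2 / pi) * A\<^sup>2 \<in> ?X" by (metis c_def)
  show "sqrt (2 / pi) * A\<^sup>2 \<le> bergman_M D z"
    unfolding bergman_M_def using mem ub by (intro cSup_upper bdd_aboveI)
  show "bergman_M D z \<le> sqrt (2 / pi) * B\<^sup>2"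
    unfolding bergman_M_def using mem ub by (intro cSup_least) auto
qed

lemma lower_rate_le_upper_rate: "A \<le> B"
  using caratheodory_metric_between by simp

text \<open>The Bergman metric is a quotient of two monotone quantities and is not itself monotone
  in the domain. So it does not lie in \<open>[A, B]\<close> for formal reasons; the weaker
  interval \<open>[A\<^sup>2 / B, B\<^sup>2 / A]\<close> contains all four functions.\<close>

lemma invariant_metrics_between:
  assumes m: "m \<in> {caratheodory_metric D, kobayashi_metric D,
              (\<lambda>z. bergman_metric D z / sqrt 2), (\<lambda>z. sqrt (pi * bergman_kernel D z))}"
  shows "A\<^sup>2 / B \<le> m z \<and> m z \<le> B\<^sup>2 / A"
proof -
  have A1: "A\<^sup>2 / B \<le> A" and B1: "B \<le> B\<^sup>2 / A"
    using lower_rate_le_upper_rate lower_rate_pos upper_rate_pos by (auto simp: field_simps power2_eq_square mult_left_mono)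
  have K: "A \<le> sqrt (pi * bergman_kernel D z)" "sqrt (pi * bergman_kernel D z) \<le> B"
    using bergman_kernel_between lower_rate_pos upper_rate_pos by (auto simp: real_le_rsqrt real_le_lsqrt)
  have "bergman_metric D z / sqrt 2 = bergman_M D z / (sqrt 2 * sqrt (bergman_kernel D z))"
    by (simp add: bergman_metric_def)
  also have "\<dots> = (bergman_M D z / sqrt (2 / pi)) / sqrt (pi * bergman_kernel D z)"
    by (simp add: real_sqrt_mult real_sqrt_divide)
  finally have eq: "bergman_metric D z / sqrt 2 = (bergman_M D z / sqrt (2 / pi)) / sqrt (pi * bergman_kernel D z)" .
  have M: "A\<^sup>2 \<le> bergman_M D z / sqrt (2 / pi)" "bergman_M D z / sqrt (2 / pi) \<le> B\<^sup>2"
    using bergman_M_between by (auto simp: field_simps)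
  have "A\<^sup>2 / B \<le> bergman_metric D z / sqrt 2"
    unfolding eq using M K lower_rate_pos order_trans[OF zero_le_power2 M(1)] less_le_trans[OF lower_rate_pos K(1)] by (intro frac_le zero_le_power2)
  moreover have "bergman_metric D z / sqrt 2 \<le> B\<^sup>2 / A"
    unfolding eq using M K lower_rate_pos order_trans[OF zero_le_power2 M(1)] less_le_trans[OF lower_rate_pos K(1)] by (intro frac_le zero_le_power2)
  ultimately show ?thesis
    using m A1 B1 K caratheodory_metric_between kobayashi_metric_between by auto
qed

end

section \<open>Slit spheres and lunes\<close>

text \<open>Comparison maps are built with the right half-plane in place of the disc; a Moebius map
  that moves the base point to the centre changes derivatives by the factor \<open>2 Re\<close>.\<close>

lemma right_half_plane_to_disc:
  fixes D :: "complex set" and s :: "complex \<Rightarrow> complex"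
  assumes D: "open D" "z \<in> D" and s: "s holomorphic_on D" "inj_on s D" "\<And>w. w \<in> D \<Longrightarrow> 0 < Re (s w)"
  obtains F where "F holomorphic_on D" "inj_on F D" "F ` D \<subseteq> ball 0 1" "F z = 0"
    "cmod (deriv F z) = cmod (deriv s z) / (2 * Re (s z))"
proof -
  define b where "b = s z"
  have b: "0 < Re b" using s(3) D(2) by (simp add: b_def)
  have nz: "s w + cnj b \<noteq> 0" if "w \<in> D" for w
    using s(3)[OF that] b by (auto simp: complex_eq_iff)
  let ?F = "\<lambda>w. (s w - b) / (s w + cnj b)"
  have "?F holomorphic_on D"
    using nz by (intro holomorphic_intros s) auto
  moreover have "inj_on ?F D"
  proof (rule inj_onI)
    fix w w' assume w: "w \<in> D" "w' \<in> D" and eq: "?F w = ?F w'"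
    then have "(s w - b) * (s w' + cnj b) = (s w' - b) * (s w + cnj b)"
      using nz by (simp add: frac_eq_eq)
    then have "(b + cnj b) * (s w - s w') = 0" by (simp add: algebra_simps)
    moreover have "b + cnj b \<noteq> 0" using b by (simp add: complex_eq_iff)
    ultimately have "s w = s w'" by simp
    then show "w = w'" using s(2) w by (auto dest: inj_onD)
  qed
  moreover have "?F ` D \<subseteq> ball 0 1"
  proof clarify
    fix w assume w: "w \<in> D"
    have "(cmod (s w - b))\<^sup>2 = (cmod (s w + cnj b))\<^sup>2 - 4 * (Re (s w) * Re b)"
      unfolding cmod_power2 by (simp add: power2_eq_square algebra_simps)
    then have "(cmod (s w - b))\<^sup>2 < (cmod (s w + cnj b))\<^sup>2"
      using s(3)[OF w] b by simp
    then have "cmod (s w - b) < cmod (s w + cnj b)"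
      by (rule power_less_imp_less_base) simp
    then show "?F w \<in> ball 0 1"
      using nz[OF w] by (simp add: norm_divide)
  qed
  moreover have "?F z = 0" by (simp add: b_def)
  moreover have "cmod (deriv ?F z) = cmod (deriv s z) / (2 * Re (s z))"
  proof -
    have "(s has_field_derivative deriv s z) (at z)"
      using s D by (intro holomorphic_derivI)
    then have "(?F has_field_derivative deriv s z / (b + cnj b)) (at z)"
      using nz[OF D(2)] by (auto intro!: derivative_eq_intros simp: b_def)
    then have "deriv ?F z = deriv s z / (b + cnj b)"
      by (rule DERIV_imp_deriv)
    moreover have "b + cnj b = of_real (2 * Re b)"
      by (simp add: complex_eq_iff)
    ultimately show ?thesis using b by (simp only: norm_divide norm_of_real) (simp add: b_def)
  qed
  ultimately show thesis by (rule that)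
qed

lemma disc_to_right_half_plane:
  fixes D :: "complex set" and \<psi> :: "complex \<Rightarrow> complex"
  defines "H \<equiv> {s. 0 < Re s}"
  assumes \<psi>: "\<psi> holomorphic_on H" "inj_on \<psi> H" "\<psi> ` H \<subseteq> D" and b: "b \<in> H" "\<psi> b = z"
  obtains \<phi> where "\<phi> holomorphic_on ball 0 1" "inj_on \<phi> (ball 0 1)" "\<phi> ` ball 0 1 \<subseteq> D" "\<phi> 0 = z"
    "cmod (deriv \<phi> 0) = cmod (deriv \<psi> b) * (2 * Re b)"
proof -
  have Reb: "0 < Re b" using b by (simp add: H_def)
  let ?m = "\<lambda>\<xi>. (b + cnj b * \<xi>) / (1 - \<xi>)"
  have nz: "1 - \<xi> \<noteq> 0" if "\<xi> \<in> ball 0 1" for \<xi> :: complex using that by auto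
  have mH: "?m \<xi> \<in> H" if "\<xi> \<in> ball 0 1" for \<xi>
  proof -
    have "Re ((b + cnj b * \<xi>) * cnj (1 - \<xi>)) = Re b * (1 - (cmod \<xi>)\<^sup>2)"
      unfolding cmod_power2 by (simp add: power2_eq_square algebra_simps)
    moreover have "0 < Re b * (1 - (cmod \<xi>)\<^sup>2)"
      using that Reb by (auto simp: abs_square_less_1)
    moreover have "Re (?m \<xi>) = Re ((b + cnj b * \<xi>) * cnj (1 - \<xi>)) / (cmod (1 - \<xi>))\<^sup>2"
      by (metis Re_divide_of_real complex_div_cnj of_real_power)
    ultimately show ?thesis using nz[OF that] by (simp add: H_def)
  qed
  have m_holo: "?m holomorphic_on ball 0 1"
    using nz by (intro holomorphic_intros)
  have m_inj: "inj_on ?m (ball 0 1)"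
  proof (rule inj_onI)
    fix x y assume xy: "x \<in> ball (0::complex) 1" "y \<in> ball 0 1" and eq: "?m x = ?m y"
    then have "(b + cnj b * x) * (1 - y) = (b + cnj b * y) * (1 - x)"
      using nz by (simp add: frac_eq_eq)
    then have "(b + cnj b) * (x - y) = 0" by (simp add: algebra_simps)
    moreover have "b + cnj b \<noteq> 0" using Reb by (simp add: complex_eq_iff)
    ultimately show "x = y" by simp
  qed
  have openH: "open H" by (simp add: H_def open_halfspace_Re_gt)
  have "\<psi> \<circ> ?m holomorphic_on ball 0 1"
    using mH by (intro holomorphic_on_compose_gen[OF m_holo \<psi>(1)]) auto
  moreover have "inj_on (\<psi> \<circ> ?m) (ball 0 1)"
    using mH by (intro comp_inj_on m_inj inj_on_subset[OF \<psi>(2)]) auto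
  moreover have "(\<psi> \<circ> ?m) ` ball 0 1 \<subseteq> D"
    using mH \<psi>(3) by (auto simp: image_subset_iff)
  moreover have "(\<psi> \<circ> ?m) 0 = z" using b by simp
  moreover have "cmod (deriv (\<psi> \<circ> ?m) 0) = cmod (deriv \<psi> b) * (2 * Re b)"
  proof -
    have "(\<psi> has_field_derivative deriv \<psi> b) (at (?m 0))"
      using \<psi>(1) b openH by (auto intro: holomorphic_derivI)
    moreover have "(?m has_field_derivative of_real (2 * Re b)) (at 0)"
      by (auto intro!: derivative_eq_intros simp: complex_eq_iff)
    ultimately have "(\<psi> \<circ> ?m has_field_derivative deriv \<psi> b * of_real (2 * Re b)) (at 0)"
      by (rule DERIV_chain)
    then have "deriv (\<psi> \<circ> ?m) 0 = deriv \<psi> b * of_real (2 * Re b)"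
      by (rule DERIV_imp_deriv)
    then show ?thesis using Reb by (simp add: norm_mult)
  qed
  ultimately show thesis by (rule that)
qed

lemma Re_csqrt_pos:
  assumes q: "q \<notin> \<real>\<^sub>\<le>\<^sub>0"
  shows "0 < Re (csqrt q)"
proof (rule ccontr)
  obtain r where r: "r = csqrt q" by simp
  assume "\<not> 0 < Re (csqrt q)"
  then have "Re r = 0" using csqrt_principal[of q] r by auto
  then have "r\<^sup>2 = - of_real ((Im r)\<^sup>2)"
    by (simp add: complex_eq_iff power2_eq_square)
  moreover have "r\<^sup>2 = q" by (simp only: r power2_csqrt)
  ultimately show False using q by (simp add: complex_nonpos_Reals_iff)
qed

text \<open>The coordinate \<open>y = n / (w - p) - c / 2\<close> sends \<open>p\<close> to infinity and the circle of
  curvature \<open>c\<close> that is tangent at \<open>p\<close> to the line orthogonal to \<open>n\<close> to the imaginary axis, with the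
  side into which \<open>n\<close> points going to the right half-plane. The set \<open>Re y = 0\<close>, \<open>1 / R \<le> \<bar>y\<bar>\<close> is an arc of this
  circle around \<open>p\<close>. The complement of the arc in the sphere is simply connected: \<open>q\<close> maps it onto the
  plane slit along the negative real axis, and the square root maps that onto a half-plane.\<close>

lemma outer_arc_map:
  fixes D :: "complex set" and n p :: complex and c R d :: real
  defines "y \<equiv> \<lambda>w. n / (w - p) - of_real (c / 2)"
  assumes D: "open D" "p + of_real d * n \<in> D" "p \<notin> D" and n: "norm n = 1" and d: "0 < d" and R: "0 < R"
    and avoid: "\<And>w. w \<in> D \<Longrightarrow> \<not> (Re (y w) = 0 \<and> 1 / R \<le> cmod (y w))"
  obtains F where "F holomorphic_on D" "inj_on F D" "F ` D \<subseteq> ball 0 1" "F (p + of_real d * n) = 0"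
    "cmod (deriv F (p + of_real d * n)) = R / (2 * d\<^sup>2 * sqrt (1 + (R * (1 / d - c / 2))\<^sup>2))"
proof -
  let ?z = "p + of_real d * n"
  have n0: "n \<noteq> 0" using n by auto
  have wp: "w - p \<noteq> 0" if "w \<in> D" for w using that D by auto
  define q where "q = (\<lambda>w. (1 + \<i> * of_real R * y w) / (1 - \<i> * of_real R * y w))"
  have den: "1 - \<i> * of_real R * y w \<noteq> 0" if "w \<in> D" for w
  proof
    assume "1 - \<i> * of_real R * y w = 0"
    then have "1 + R * Im (y w) = 0" "R * Re (y w) = 0" by (simp_all add: complex_eq_iff)
    then have "Re (y w) = 0" "Im (y w) = - 1 / R" using R by (auto simp: field_simps)
    then show False using avoid[OF that] R by (simp add: cmod_def)
  qed
  have qn: "q w \<notin> \<real>\<^sub>\<le>\<^sub>0" if "w \<in> D" for w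
  proof
    assume "q w \<in> \<real>\<^sub>\<le>\<^sub>0"
    then obtain t where t: "q w = of_real t" "t \<le> 0" by (auto elim: nonpos_Reals_cases)
    have eq: "1 + \<i> * of_real R * y w = of_real t * (1 - \<i> * of_real R * y w)"
      using t(1) den[OF that] by (simp add: q_def divide_eq_eq)
    have e: "1 - R * Im (y w) = t * (1 + R * Im (y w))" "R * Re (y w) = - (t * (R * Re (y w)))"
      using arg_cong[OF eq, of Re] arg_cong[OF eq, of Im] by simp_all
    have e': "(1 + t) * (R * Im (y w)) = 1 - t" "(1 + t) * (R * Re (y w)) = 0"
      using e unfolding distrib_left distrib_right mult_1 mult_1_right by linarith+
    have t1: "1 + t \<noteq> 0" using e'(1) t(2) by auto
    then have re: "Re (y w) = 0" using e'(2) R by simp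
    have "\<bar>1 + t\<bar> * (R * \<bar>Im (y w)\<bar>) = 1 - t"
      using e'(1) R t(2) by (metis abs_mult abs_of_pos abs_of_nonneg diff_ge_0_iff_ge order_trans zero_le_one)
    moreover have "\<bar>1 + t\<bar> \<le> 1 - t" using t(2) by auto
    ultimately have "\<bar>1 + t\<bar> * 1 \<le> \<bar>1 + t\<bar> * (R * \<bar>Im (y w)\<bar>)" by simp
    then have "1 \<le> R * \<bar>Im (y w)\<bar>" using t1 by (subst (asm) mult_le_cancel_left_pos) auto
    then have "1 / R \<le> cmod (y w)" using R re by (simp add: cmod_def field_simps)
    then show False using avoid[OF that] re by simp
  qed
  define s where "s = (\<lambda>w. csqrt (q w))"
  have y_holo: "y holomorphic_on D" unfolding y_def
    using wp by (intro holomorphic_intros)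
  have q_holo: "q holomorphic_on D" unfolding q_def
    using den by (intro holomorphic_intros y_holo)
  have s_holo: "s holomorphic_on D" unfolding s_def
    using qn by (intro holomorphic_intros q_holo)
  have s_inj: "inj_on s D"
  proof (rule inj_onI)
    fix w w' assume w: "w \<in> D" "w' \<in> D" and "s w = s w'"
    then have "(csqrt (q w))\<^sup>2 = (csqrt (q w'))\<^sup>2" by (simp add: s_def)
    then have "q w = q w'" by simp
    then have "(1 + \<i> * of_real R * y w) * (1 - \<i> * of_real R * y w') =
        (1 + \<i> * of_real R * y w') * (1 - \<i> * of_real R * y w)"
      using den w by (simp add: q_def frac_eq_eq)
    then have "\<i> * of_real R * (y w - y w') = 0" by (simp add: algebra_simps)
    then have "n / (w - p) = n / (w' - p)" using R by (simp add: y_def)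
    then show "w = w'" using wp w n0 by (simp add: frac_eq_eq)
  qed
  have s_pos: "0 < Re (s w)" if "w \<in> D" for w
    unfolding s_def using qn[OF that] by (rule Re_csqrt_pos)
  define X where "X = R * (1 / d - c / 2)"
  have yz: "y ?z = of_real (1 / d - c / 2)"
    using n0 by (simp add: y_def)
  have Ry: "of_real R * y ?z = of_real X" by (simp only: yz X_def of_real_mult)
  have X0: "1 - \<i> * of_real X \<noteq> 0" by (simp add: complex_eq_iff)
  have X1: "0 < sqrt (1 + X\<^sup>2)" by (simp add: add_pos_nonneg)
  \<comment> \<open>On the normal the coordinate is real, so the square root is explicit and unimodular.\<close>
  have sz: "s ?z = (1 + \<i> * of_real X) / of_real (sqrt (1 + X\<^sup>2))"
    unfolding s_def
  proof (rule csqrt_unique)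
    have qz: "q ?z = (1 + \<i> * of_real X) / (1 - \<i> * of_real X)"
      by (simp only: q_def mult.assoc Ry)
    have "((1 + \<i> * of_real X) / of_real (sqrt (1 + X\<^sup>2)))\<^sup>2 = (1 + \<i> * of_real X)\<^sup>2 / of_real (1 + X\<^sup>2)"
      by (simp add: power_divide flip: of_real_power)
    also have "of_real (1 + X\<^sup>2) = (1 + \<i> * of_real X) * (1 - \<i> * of_real X)"
      by (simp add: complex_eq_iff power2_eq_square)
    also have "(1 + \<i> * of_real X)\<^sup>2 / \<dots> = q ?z"
    proof -
      have "1 + \<i> * of_real X \<noteq> 0" by (simp add: complex_eq_iff)
      then show ?thesis unfolding qz by (simp add: power2_eq_square)
    qed
    finally show "((1 + \<i> * of_real X) / of_real (sqrt (1 + X\<^sup>2)))\<^sup>2 = q ?z" .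
  qed (use X1 in auto)
  have Resz: "Re (s ?z) = 1 / sqrt (1 + X\<^sup>2)"
    by (simp add: sz)
  have cmod1: "cmod (1 + \<i> * of_real X) = sqrt (1 + X\<^sup>2)" "cmod (1 - \<i> * of_real X) = sqrt (1 + X\<^sup>2)"
    by (simp_all add: cmod_def)
  have nsz: "cmod (s ?z) = 1"
    unfolding sz norm_divide cmod1 using X1 by simp
  have dy: "(y has_field_derivative - n / (?z - p)\<^sup>2) (at ?z)"
    unfolding y_def using wp[OF D(2)] by (auto intro!: derivative_eq_intros simp: power2_eq_square)
  have dq: "(q has_field_derivative (2 * \<i> * of_real R / (1 - \<i> * of_real X)\<^sup>2) * (- n / (?z - p)\<^sup>2)) (at ?z)"
  proof -
    define E where "E = - n / (?z - p)\<^sup>2"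
    have "(q has_field_derivative ((\<i> * of_real R * E) * (1 - \<i> * of_real R * y ?z) -
        (1 + \<i> * of_real R * y ?z) * (- (\<i> * of_real R * E))) /
        ((1 - \<i> * of_real R * y ?z) * (1 - \<i> * of_real R * y ?z))) (at ?z)"
      unfolding q_def using den[OF D(2)] dy[folded E_def]
      by (intro DERIV_divide) (auto intro!: derivative_eq_intros)
    moreover have "((\<i> * of_real R * E) * (1 - \<i> * of_real R * y ?z) -
        (1 + \<i> * of_real R * y ?z) * (- (\<i> * of_real R * E))) = 2 * \<i> * of_real R * E"
      by (simp add: algebra_simps)
    moreover have "2 * \<i> * of_real R * E / ((1 - \<i> * of_real R * y ?z) * (1 - \<i> * of_real R * y ?z)) =
        (2 * \<i> * of_real R / (1 - \<i> * of_real X)\<^sup>2) * E"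
      by (simp only: mult.assoc Ry power2_eq_square times_divide_eq_left)
    ultimately show ?thesis by (simp only: E_def[symmetric])
  qed
  have ds: "deriv s ?z = (2 * \<i> * of_real R / (1 - \<i> * of_real X)\<^sup>2) * (- n / (?z - p)\<^sup>2) / (2 * s ?z)"
  proof -
    have "(csqrt has_field_derivative inverse (2 * csqrt (q ?z))) (at (q ?z))"
      using qn[OF D(2)] by (rule has_field_derivative_csqrt)
    from DERIV_chain2[OF this dq, folded s_def]
    have "deriv s ?z = inverse (2 * s ?z) * (2 * \<i> * of_real R / (1 - \<i> * of_real X)\<^sup>2 * (- n / (?z - p)\<^sup>2))"
      unfolding s_def by (rule DERIV_imp_deriv)
    then show ?thesis by (simp only: divide_inverse[of _ "2 * s ?z"] mult.commute[of "inverse (2 * s ?z)"])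
  qed
  have nds: "cmod (deriv s ?z) = R / (sqrt (1 + X\<^sup>2))\<^sup>2 / d\<^sup>2"
    unfolding ds norm_divide norm_mult norm_power nsz cmod1 using n R d by (simp add: norm_mult)
  obtain F where F: "F holomorphic_on D" "inj_on F D" "F ` D \<subseteq> ball 0 1" "F ?z = 0"
      "cmod (deriv F ?z) = cmod (deriv s ?z) / (2 * Re (s ?z))"
    using right_half_plane_to_disc[OF D(1,2) s_holo s_inj s_pos] by metis
  have "cmod (deriv F ?z) = R / (2 * d\<^sup>2 * sqrt (1 + X\<^sup>2))"
  proof -
    have "R / r\<^sup>2 / d\<^sup>2 / (2 * (1 / r)) = R / (2 * d\<^sup>2 * r)" if "0 < r" for r
      using that d by (simp add: field_simps power2_eq_square)
    from this[OF X1] show ?thesis unfolding F(5) nds Resz .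
  qed
  with F show thesis unfolding X_def by (intro that)
qed

text \<open>In the coordinate \<open>y\<close> of the previous lemma, the lune that an orthogonal circle around
  \<open>p\<close> cuts from the inner side of the tangent circle of curvature \<open>c\<close> becomes \<open>Re y > 0\<close>, \<open>1 / R < \<bar>y\<bar>\<close>. Its
  boundary arcs meet at right angles, so a Moebius map takes it onto a quadrant, and squaring takes the
  quadrant onto a half-plane; \<open>\<psi>\<close> is the inverse of this chain. The domain enters only through its
  connected subsets: whether the image of \<open>\<psi>\<close> lies in \<open>D\<close> will be decided by its not meeting
  the frontier.\<close>

lemma inner_lune_map:
  fixes D :: "complex set" and n p :: complex and c R d :: real
  assumes n: "norm n = 1" and d: "0 < d" and R: "0 < R" "R * \<bar>c\<bar> < 2" and Rd: "1 < R * (1 / d - c / 2)"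
    and D: "\<And>T. connected T \<Longrightarrow> p + of_real d * n \<in> T \<Longrightarrow>
      T \<subseteq> {p + n / (y + of_real (c / 2)) | y. 0 < Re y \<and> 1 / R < cmod y} \<Longrightarrow> T \<subseteq> D"
  obtains \<phi> where "\<phi> holomorphic_on ball 0 1" "inj_on \<phi> (ball 0 1)" "\<phi> ` ball 0 1 \<subseteq> D"
    "\<phi> 0 = p + of_real d * n"
    "cmod (deriv \<phi> 0) = 2 * d\<^sup>2 * (R * (1 / d - c / 2)) * ((R * (1 / d - c / 2))\<^sup>2 - 1) /
       (R * ((R * (1 / d - c / 2))\<^sup>2 + 1))"
proof -
  define X where "X = R * (1 / d - c / 2)"
  have X: "1 < X" using Rd by (simp add: X_def)
  have n0: "n \<noteq> 0" using n by auto
  let ?z = "p + of_real d * n"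
  let ?H = "{s. 0 < Re s}"
  define q where "q = (\<lambda>Q. csqrt (\<i> * Q))"
  define y where "y = (\<lambda>t. \<i> * (t + 1) / (t - 1) / of_real R)"
  define \<psi> where "\<psi> = (\<lambda>Q. p + n / (y (q Q) + of_real (c / 2)))"
  have nonpos: "\<i> * Q \<notin> \<real>\<^sub>\<le>\<^sub>0" if "Q \<in> ?H" for Q
    using that by (auto simp: complex_nonpos_Reals_iff)
  have q2: "(q Q)\<^sup>2 = \<i> * Q" for Q by (simp add: q_def)
  have Req: "0 < Re (q Q)" if "Q \<in> ?H" for Q
    unfolding q_def by (intro Re_csqrt_pos nonpos that)
  have Imq: "0 < Im (q Q)" if "Q \<in> ?H" for Q
  proof -
    have "2 * (Re (q Q) * Im (q Q)) = Re Q"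
      using arg_cong[OF q2[of Q], of Im] by (simp add: power2_eq_square mult.commute)
    then have "0 < Re (q Q) * Im (q Q)" using that by auto
    then show ?thesis using Req[OF that] by (simp add: zero_less_mult_iff)
  qed
  have q1: "q Q - 1 \<noteq> 0" if "Q \<in> ?H" for Q
    using Imq[OF that] by (auto simp: complex_eq_iff)
  have y_region: "0 < Re (y t)" "1 / R < cmod (y t)" if "0 < Re t" "0 < Im t" for t
  proof -
    have t1: "t - 1 \<noteq> 0" using that by (auto simp: complex_eq_iff)
    have "Re (y t) = Re (\<i> * (t + 1) / (t - 1)) / R"
      by (simp only: y_def Re_divide_of_real)
    also have "Re (\<i> * (t + 1) / (t - 1)) = 2 * Im t / (cmod (t - 1))\<^sup>2"
      by (simp add: Re_divide cmod_power2 algebra_simps)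
    finally show "0 < Re (y t)" using that R t1 by simp
    have "(cmod (t - 1))\<^sup>2 < (cmod (t + 1))\<^sup>2"
      unfolding cmod_power2 using that by (simp add: power2_eq_square algebra_simps)
    then have "cmod (t - 1) < cmod (t + 1)"
      by (rule power_less_imp_less_base) simp
    then show "1 / R < cmod (y t)"
      using R t1 by (simp add: y_def norm_divide norm_mult pos_divide_less_eq less_divide_eq)
  qed
  have yc: "y t + of_real (c / 2) \<noteq> 0" if "0 < Re t" "0 < Im t" for t
  proof
    assume "y t + of_real (c / 2) = 0"
    then have "y t = of_real (- c / 2)" by (simp add: eq_neg_iff_add_eq_0)
    then have "cmod (y t) = \<bar>c\<bar> / 2" by (simp only: norm_of_real)
    then have "\<bar>c\<bar> = 2 * cmod (y t)" by linarith
    then have "R * \<bar>c\<bar> = 2 * (R * cmod (y t))" by (simp only: mult.left_commute)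
    moreover have "1 < R * cmod (y t)" using y_region(2)[OF that] R by (simp add: field_simps)
    ultimately show False using R(2) by linarith
  qed
  have q_holo: "q holomorphic_on ?H"
    unfolding q_def using nonpos by (intro holomorphic_intros) auto
  have yq_holo: "(\<lambda>Q. y (q Q)) holomorphic_on ?H"
    unfolding y_def using q1 R by (intro holomorphic_intros q_holo) auto
  have \<psi>_holo: "\<psi> holomorphic_on ?H"
    unfolding \<psi>_def using yc Req Imq by (intro holomorphic_intros yq_holo) auto
  have \<psi>_inj: "inj_on \<psi> ?H"
  proof (rule inj_onI)
    fix P Q assume PQ: "P \<in> ?H" "Q \<in> ?H" and "\<psi> P = \<psi> Q"
    then have "n / (y (q P) + of_real (c / 2)) = n / (y (q Q) + of_real (c / 2))"
      by (simp add: \<psi>_def)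
    then have "y (q P) = y (q Q)"
      using n0 yc Req Imq PQ by (simp add: frac_eq_eq)
    then have "\<i> * (q P + 1) / (q P - 1) = \<i> * (q Q + 1) / (q Q - 1)"
      unfolding y_def using R by (subst (asm) divide_cancel_right) simp
    then have "(q P + 1) * (q Q - 1) = (q Q + 1) * (q P - 1)"
      using q1 PQ by (simp add: frac_eq_eq)
    then have "2 * (q Q - q P) = 0" by (simp add: algebra_simps)
    then have "(q P)\<^sup>2 = (q Q)\<^sup>2" by simp
    then show "P = Q" by (simp add: q2)
  qed
  \<comment> \<open>The point of the quadrant that corresponds to the base point, where \<open>R y = X\<close>.\<close>
  define t0 where "t0 = (of_real X + \<i>) / (of_real X - \<i>)"
  have t0_eq: "t0 = Complex ((X\<^sup>2 - 1) / (X\<^sup>2 + 1)) (2 * X / (X\<^sup>2 + 1))"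
    by (simp add: t0_def complex_eq_iff Re_divide Im_divide power2_eq_square)
  have X2: "0 < X\<^sup>2 - 1" "0 < X\<^sup>2 + 1" using X by (auto simp: add_pos_nonneg)
  have t0_pos: "0 < Re t0" "0 < Im t0"
    using X X2 by (auto simp: t0_eq)
  define Q0 where "Q0 = - \<i> * t0\<^sup>2"
  have ReQ0: "Re Q0 = 4 * X * (X\<^sup>2 - 1) / (X\<^sup>2 + 1)\<^sup>2"
    by (simp add: Q0_def t0_eq power2_eq_square)
  have Q0H: "Q0 \<in> ?H"
    using X X2 by (simp add: ReQ0)
  have qQ0: "q Q0 = t0"
    unfolding q_def by (rule csqrt_unique) (use t0_pos in \<open>auto simp: Q0_def\<close>)
  have Xi: "of_real X - \<i> \<noteq> 0" "cmod (of_real X - \<i>) = sqrt (X\<^sup>2 + 1)" "cmod (of_real X + \<i>) = sqrt (X\<^sup>2 + 1)"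
    by (auto simp: complex_eq_iff cmod_def)
  have nt0: "cmod t0 = 1"
    using X2 by (simp add: t0_def norm_divide Xi)
  have t01: "t0 - 1 = 2 * \<i> / (of_real X - \<i>)" "t0 + 1 = 2 * of_real X / (of_real X - \<i>)"
    using Xi(1) by (auto simp: t0_def field_simps)
  have yt0: "y t0 = of_real (1 / d - c / 2)"
  proof -
    have "y t0 = of_real X / of_real R"
    proof -
      have "\<i> * (t0 + 1) = of_real X * (t0 - 1)" by (simp add: t01)
      moreover have "t0 - 1 \<noteq> 0" using t0_pos(2) by (auto simp: complex_eq_iff)
      ultimately show ?thesis by (simp add: y_def)
    qed
    also have "\<dots> = of_real (X / R)" by simp
    also have "X / R = 1 / d - c / 2" using R by (simp add: X_def)
    finally show ?thesis .
  qed
  have yt0': "y t0 + of_real (c / 2) = of_real (1 / d)"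
    unfolding yt0 by (simp flip: of_real_add)
  have \<psi>Q0: "\<psi> Q0 = ?z"
    unfolding \<psi>_def qQ0 yt0' by (simp add: mult.commute)
  have "connected (\<psi> ` ?H)"
    by (intro connected_continuous_image holomorphic_on_imp_continuous_on \<psi>_holo convex_connected
        convex_halfspace_Re_gt)
  then have \<psi>_img: "\<psi> ` ?H \<subseteq> D"
  proof (rule D)
    show "?z \<in> \<psi> ` ?H" using Q0H \<psi>Q0 by (metis imageI)
    show "\<psi> ` ?H \<subseteq> {p + n / (y + of_real (c / 2)) | y. 0 < Re y \<and> 1 / R < cmod y}"
      unfolding \<psi>_def using y_region Req Imq by blast
  qed
  have dq: "(q has_field_derivative \<i> / (2 * t0)) (at Q0)"
  proof -
    have "(csqrt has_field_derivative inverse (2 * csqrt (\<i> * Q0))) (at (\<i> * Q0))"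
      using nonpos[OF Q0H] by (rule has_field_derivative_csqrt)
    moreover have "((*) \<i> has_field_derivative \<i>) (at Q0)"
      by (auto intro!: derivative_eq_intros)
    ultimately have "((\<lambda>Q. csqrt (\<i> * Q)) has_field_derivative inverse (2 * csqrt (\<i> * Q0)) * \<i>) (at Q0)"
      by (rule DERIV_chain2)
    moreover have "inverse (2 * csqrt (\<i> * Q0)) * \<i> = \<i> / (2 * t0)"
      by (simp only: qQ0[unfolded q_def] divide_inverse mult.commute)
    ultimately show ?thesis by (simp only: q_def)
  qed
  have dy: "(y has_field_derivative - 2 * \<i> / (of_real R * (t0 - 1)\<^sup>2)) (at t0)"
  proof -
    have t1: "t0 - 1 \<noteq> 0" using t0_pos(2) by (auto simp: complex_eq_iff)
    have "((\<lambda>t. \<i> * (t + 1)) has_field_derivative \<i>) (at t0)" "((\<lambda>t. t - 1) has_field_derivative 1) (at t0)"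
      by (auto intro!: derivative_eq_intros)
    from DERIV_cdivide[OF DERIV_divide[OF this t1], of "of_real R"]
    have "(y has_field_derivative
        (\<i> * (t0 - 1) - \<i> * (t0 + 1) * 1) / ((t0 - 1) * (t0 - 1)) / of_real R) (at t0)"
      unfolding y_def .
    moreover have "\<i> * (t0 - 1) - \<i> * (t0 + 1) * 1 = - 2 * \<i>" by (simp add: algebra_simps)
    moreover have "- 2 * \<i> / ((t0 - 1) * (t0 - 1)) / of_real R = - 2 * \<i> / (of_real R * (t0 - 1)\<^sup>2)"
      by (simp only: power2_eq_square divide_divide_eq_left mult.commute)
    ultimately show ?thesis by (simp only:)
  qed
  define E where "E = - 2 * \<i> / (of_real R * (t0 - 1)\<^sup>2) * (\<i> / (2 * t0))"
  have "(y has_field_derivative - 2 * \<i> / (of_real R * (t0 - 1)\<^sup>2)) (at (q Q0))"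
    using dy by (simp only: qQ0)
  from DERIV_chain2[OF this dq] have "((\<lambda>Q. y (q Q)) has_field_derivative E) (at Q0)"
    by (simp only: E_def)
  from DERIV_add[OF this DERIV_const]
  have dY: "((\<lambda>Q. y (q Q) + of_real (c / 2)) has_field_derivative E + 0) (at Q0)" .
  have "y (q Q0) + of_real (c / 2) \<noteq> 0" unfolding qQ0 by (rule yc[OF t0_pos])
  from DERIV_add[OF DERIV_const[of p] DERIV_divide[OF DERIV_const[of n] dY this]]
  have "(\<psi> has_field_derivative - n * E / (of_real (1 / d))\<^sup>2) (at Q0)"
    by (simp only: \<psi>_def qQ0 yt0' power2_eq_square add_0 add_0_right mult_zero_left diff_0 mult_minus_left)
  then have d\<psi>: "deriv \<psi> Q0 = - n * E / (of_real (1 / d))\<^sup>2"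
    by (rule DERIV_imp_deriv)
  have nt01: "(cmod (t0 - 1))\<^sup>2 = 4 / (X\<^sup>2 + 1)"
    using X2 by (simp add: t01 norm_divide Xi power_divide norm_mult)
  have nd\<psi>: "cmod (deriv \<psi> Q0) = d\<^sup>2 * (X\<^sup>2 + 1) / (4 * R)"
  proof -
    have "cmod (deriv \<psi> Q0) = 1 * (2 * 1 / (\<bar>R\<bar> * (cmod (t0 - 1))\<^sup>2) * (1 / (2 * 1))) / \<bar>1 / d\<bar>\<^sup>2"
      unfolding d\<psi> E_def
      by (simp only: norm_divide norm_mult norm_minus_cancel norm_power norm_of_real norm_ii norm_numeral n nt0)
    also have "\<dots> = d\<^sup>2 * (X\<^sup>2 + 1) / (4 * R)"
      unfolding nt01 using R d by (simp add: power_divide field_simps)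
    finally show ?thesis .
  qed
  obtain \<phi> where \<phi>: "\<phi> holomorphic_on ball 0 1" "inj_on \<phi> (ball 0 1)" "\<phi> ` ball 0 1 \<subseteq> D" "\<phi> 0 = ?z"
      "cmod (deriv \<phi> 0) = cmod (deriv \<psi> Q0) * (2 * Re Q0)"
    using disc_to_right_half_plane[OF \<psi>_holo \<psi>_inj \<psi>_img Q0H \<psi>Q0] by metis
  have "cmod (deriv \<phi> 0) = 2 * d\<^sup>2 * X * (X\<^sup>2 - 1) / (R * (X\<^sup>2 + 1))"
    unfolding \<phi>(5) nd\<psi> ReQ0 using X2 R by (simp add: divide_simps power2_eq_square)
  with \<phi> show thesis unfolding X_def by (intro that)
qed

section \<open>Nearest points on twice continuously differentiable arcs\<close>

text \<open>Taylor expansion about a moving point \<open>t\<close>, with the second derivative frozen at \<open>t0\<close>.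
  The mean value inequality is applied twice, to \<open>g'\<close> and then to \<open>g\<close>.\<close>

lemma C2_taylor_uniform:
  fixes g g' g'' :: "real \<Rightarrow> 'a::real_normed_vector"
  assumes g: "\<And>t. t \<in> I \<Longrightarrow> (g has_vector_derivative g' t) (at t within I)"
    and g': "\<And>t. t \<in> I \<Longrightarrow> (g' has_vector_derivative g'' t) (at t within I)"
    and g'': "continuous_on I g''" and I: "convex I" "t0 \<in> I" and \<eta>: "0 < \<eta>"
  obtains \<delta> where "0 < \<delta>"
    "\<And>s t. s \<in> I \<Longrightarrow> t \<in> I \<Longrightarrow> \<bar>s - t0\<bar> < \<delta> \<Longrightarrow> \<bar>t - t0\<bar> < \<delta> \<Longrightarrow>
       norm (g s - g t - (s - t) *\<^sub>R g' t - ((s - t)\<^sup>2 / 2) *\<^sub>R g'' t0) \<le> \<eta> * (s - t)\<^sup>2"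
proof -
  obtain \<delta> where \<delta>: "0 < \<delta>" "\<And>t. t \<in> I \<Longrightarrow> dist t t0 < \<delta> \<Longrightarrow> dist (g'' t) (g'' t0) < \<eta>"
    using g'' I(2) \<eta> unfolding continuous_on_iff by metis
  have "norm (g s - g t - (s - t) *\<^sub>R g' t - ((s - t)\<^sup>2 / 2) *\<^sub>R g'' t0) \<le> \<eta> * (s - t)\<^sup>2"
    if st: "s \<in> I" "t \<in> I" "\<bar>s - t0\<bar> < \<delta>" "\<bar>t - t0\<bar> < \<delta>" for s t
  proof -
    define J where "J = closed_segment t s"
    have JI: "J \<subseteq> I" unfolding J_def using I(1) st closed_segment_subset by blast
    have Jd: "\<bar>x - t0\<bar> < \<delta>" "\<bar>x - t\<bar> \<le> \<bar>s - t\<bar>" if "x \<in> J" for x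
      using that st unfolding J_def by (auto simp: closed_segment_eq_real_ivl split: if_splits)
    have tJ: "t \<in> J" "s \<in> J" by (auto simp: J_def)
    have first: "norm (g' x - g' t - (x - t) *\<^sub>R g'' t0) \<le> \<eta> * \<bar>x - t\<bar>" if x: "x \<in> J" for x
    proof -
      let ?k = "\<lambda>x. g' x - x *\<^sub>R g'' t0"
      have "norm (?k x - ?k t) \<le> \<eta> * norm (x - t)"
      proof (rule differentiable_bound[of J ?k "\<lambda>y h. h *\<^sub>R (g'' y - g'' t0)"])
        show "convex J" by (simp add: J_def)
        show "(?k has_derivative (\<lambda>h. h *\<^sub>R (g'' y - g'' t0))) (at y within J)" if "y \<in> J" for y
        proof -
          have "(?k has_vector_derivative g'' y - 1 *\<^sub>R g'' t0) (at y within J)"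
            using that JI by (auto intro!: derivative_eq_intros has_vector_derivative_within_subset[OF g'])
          then show ?thesis by (simp add: has_vector_derivative_def)
        qed
        show "onorm (\<lambda>h. h *\<^sub>R (g'' y - g'' t0)) \<le> \<eta>" if "y \<in> J" for y
        proof (rule onorm_bound)
          have "norm (g'' y - g'' t0) \<le> \<eta>"
            using \<delta>(2)[of y] that JI Jd by (force simp: dist_norm)
          then show "norm (h *\<^sub>R (g'' y - g'' t0)) \<le> \<eta> * norm h" for h :: real
            using mult_left_mono[OF \<open>norm (g'' y - g'' t0) \<le> \<eta>\<close> norm_ge_zero[of h]]
            by (simp add: mult.commute)
        qed (use \<eta> in simp)
      qed (use x tJ in auto)
      then show ?thesis by (simp add: algebra_simps)
    qed
    let ?m = "\<lambda>x. g x - g t - (x - t) *\<^sub>R g' t - ((x - t)\<^sup>2 / 2) *\<^sub>R g'' t0"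
    have "norm (?m s - ?m t) \<le> (\<eta> * \<bar>s - t\<bar>) * norm (s - t)"
    proof (rule differentiable_bound[of J ?m "\<lambda>y h. h *\<^sub>R (g' y - g' t - (y - t) *\<^sub>R g'' t0)"])
      show "convex J" by (simp add: J_def)
      show "(?m has_derivative (\<lambda>h. h *\<^sub>R (g' y - g' t - (y - t) *\<^sub>R g'' t0))) (at y within J)" if "y \<in> J" for y
      proof -
        have "(?m has_vector_derivative g' y - g' t - (y - t) *\<^sub>R g'' t0) (at y within J)"
          using that JI
          by (auto intro!: derivative_eq_intros has_vector_derivative_within_subset[OF g])
        then show ?thesis by (simp add: has_vector_derivative_def)
      qed
      show "onorm (\<lambda>h. h *\<^sub>R (g' y - g' t - (y - t) *\<^sub>R g'' t0)) \<le> \<eta> * \<bar>s - t\<bar>" if "y \<in> J" for y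
      proof (rule onorm_bound)
        have "norm (g' y - g' t - (y - t) *\<^sub>R g'' t0) \<le> \<eta> * \<bar>s - t\<bar>"
          using first[OF that] Jd(2)[OF that] \<eta> by (meson mult_left_mono order_trans less_imp_le)
        then show "norm (h *\<^sub>R (g' y - g' t - (y - t) *\<^sub>R g'' t0)) \<le> \<eta> * \<bar>s - t\<bar> * norm h" for h :: real
          by (simp add: mult.commute mult_left_mono)
      qed (use \<eta> in simp)
    qed (use tJ in auto)
    then show ?thesis by (simp add: power2_eq_square mult.assoc)
  qed
  with \<delta>(1) show thesis by (rule that)
qed

lemma Re_divide_eq_inner: "Re (n / h) = (h \<bullet> n) / (norm h)\<^sup>2"
  by (simp add: Re_divide inner_complex_def cmod_power2 mult.commute)

text \<open>For a unit vector \<open>n\<close>, \<open>Re (n / h) = (h \<bullet> n) / \<bar>h\<bar>\<^sup>2\<close> is half the curvature of the circle through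
  \<open>0\<close> and \<open>h\<close> with normal \<open>n\<close> at \<open>0\<close>. Along a \<open>C\<^sup>2\<close> arc this tends to half the curvature of the arc,
  jointly in both endpoints of the chord. The joint limit is needed because the nearest boundary
  point moves with \<open>z\<close>.\<close>

lemma chord_normal_tendsto:
  assumes arc: "C2_regular_arc g g' g''" and t0: "t0 \<in> {0..1}"
  shows "((\<lambda>(s, t). Re (unit_normal \<sigma> (g' t) / (g s - g t))) \<longlongrightarrow>
     (g'' t0 \<bullet> unit_normal \<sigma> (g' t0)) / (norm (g' t0))\<^sup>2 / 2)
     (at (t0, t0) within {(s, t). s \<in> {0..1} \<and> t \<in> {0..1} \<and> s \<noteq> t})"
proof -
  define P where "P = {(s::real, t::real). s \<in> {0..1} \<and> t \<in> {0..1} \<and> s \<noteq> t}"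
  define F where "F = at (t0, t0) within P"
  have g: "(g has_vector_derivative g' t) (at t within {0..1})"
    and g': "(g' has_vector_derivative g'' t) (at t within {0..1})" and nz: "g' t \<noteq> 0" if "t \<in> {0..1}" for t
    using arc that by (auto simp: C2_regular_arc_def)
  have g'': "continuous_on {0..1} g''" using arc by (simp add: C2_regular_arc_def)
  have g'_cont: "continuous_on {0..1} g'"
    by (meson g' continuous_on_eq_continuous_within has_vector_derivative_continuous)
  have evP: "eventually (\<lambda>st. st \<in> P) F"
    unfolding F_def by (auto simp: eventually_at_filter)
  have st_lim: "((\<lambda>st. fst st) \<longlongrightarrow> t0) F" "((\<lambda>st. snd st) \<longlongrightarrow> t0) F"
    unfolding F_def by (auto intro!: tendsto_eq_intros)
  have comp: "((\<lambda>st. f (snd st)) \<longlongrightarrow> f t0) F" if "continuous_on {0..1} f" for f :: "real \<Rightarrow> complex"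
    by (rule continuous_on_tendsto_compose[OF that st_lim(2) t0]) (use evP in \<open>auto elim!: eventually_mono simp: P_def\<close>)
  have g'_lim: "((\<lambda>st. g' (snd st)) \<longlongrightarrow> g' t0) F"
    by (rule comp[OF g'_cont])
  have \<nu>_lim: "((\<lambda>st. unit_normal \<sigma> (g' (snd st))) \<longlongrightarrow> unit_normal \<sigma> (g' t0)) F"
    unfolding unit_normal_def sgn_div_norm using g'_lim nz[OF t0] by (auto intro!: tendsto_intros)
  define r where "r = (\<lambda>st. fst st - snd st :: real)"
  define h where "h = (\<lambda>st. g (fst st) - g (snd st))"
  define e where "e = (\<lambda>st. (h st - r st *\<^sub>R g' (snd st) - ((r st)\<^sup>2 / 2) *\<^sub>R g'' t0) /\<^sub>R (r st)\<^sup>2)"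
  have rnz: "r st \<noteq> 0" if "st \<in> P" for st using that by (auto simp: r_def P_def)
  have r_lim: "(r \<longlongrightarrow> 0) F"
    unfolding r_def by (rule tendsto_eq_intros st_lim)+ simp
  have e_lim: "(e \<longlongrightarrow> 0) F"
  proof (rule tendstoI)
    fix \<eta> :: real assume \<eta>: "0 < \<eta>"
    then have "0 < \<eta> / 2" by simp
    from C2_taylor_uniform[OF g g' g'' convex_real_interval(5) t0 this]
    obtain \<delta> where \<delta>: "0 < \<delta>" "\<And>s t. s \<in> {0..1} \<Longrightarrow> t \<in> {0..1} \<Longrightarrow> \<bar>s - t0\<bar> < \<delta> \<Longrightarrow> \<bar>t - t0\<bar> < \<delta> \<Longrightarrow>
       norm (g s - g t - (s - t) *\<^sub>R g' t - ((s - t)\<^sup>2 / 2) *\<^sub>R g'' t0) \<le> \<eta> / 2 * (s - t)\<^sup>2" by blast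
    have "eventually (\<lambda>st. dist (fst st) t0 < \<delta>) F" "eventually (\<lambda>st. dist (snd st) t0 < \<delta>) F"
      using st_lim \<delta>(1) by (auto dest: tendstoD)
    then show "eventually (\<lambda>st. dist (e st) 0 < \<eta>) F"
      using evP
    proof eventually_elim
      case (elim st)
      then have "norm (h st - r st *\<^sub>R g' (snd st) - ((r st)\<^sup>2 / 2) *\<^sub>R g'' t0) \<le> \<eta> / 2 * (r st)\<^sup>2"
        using \<delta>(2)[of "fst st" "snd st"] by (auto simp: h_def r_def P_def dist_real_def)
      note Bd = this
      have r2: "0 < (r st)\<^sup>2" using rnz elim by simp
      have eN: "norm (e st) = norm (h st - r st *\<^sub>R g' (snd st) - ((r st)\<^sup>2 / 2) *\<^sub>R g'' t0) / (r st)\<^sup>2"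
        by (simp only: e_def norm_scaleR abs_inverse abs_power2 divide_inverse_commute)
      have "norm (e st) \<le> \<eta> / 2"
        unfolding eN pos_divide_le_eq[OF r2] by (rule Bd)
      then show ?case using \<eta> by simp
    qed
  qed
  \<comment> \<open>The linear term of the expansion is orthogonal to the normal, so only the quadratic term survives in the numerator.\<close>
  have h_eq: "h st = r st *\<^sub>R g' (snd st) + (r st)\<^sup>2 *\<^sub>R ((1 / 2) *\<^sub>R g'' t0 + e st)" if "st \<in> P" for st
    using rnz[OF that] by (simp add: e_def algebra_simps)
  have k_lim: "((\<lambda>st. norm (g' (snd st) + r st *\<^sub>R ((1 / 2) *\<^sub>R g'' t0 + e st))) \<longlongrightarrow>
      norm (g' t0 + 0 *\<^sub>R ((1 / 2) *\<^sub>R g'' t0 + 0))) F"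
    by (intro tendsto_intros g'_lim r_lim e_lim)
  have q_lim: "((\<lambda>st. ((1 / 2) *\<^sub>R g'' t0 + e st) \<bullet> unit_normal \<sigma> (g' (snd st))) \<longlongrightarrow>
      ((1 / 2) *\<^sub>R g'' t0 + 0) \<bullet> unit_normal \<sigma> (g' t0)) F"
    by (intro tendsto_intros \<nu>_lim e_lim)
  have orth: "v \<bullet> unit_normal \<sigma> v = 0" for v
    by (simp add: unit_normal_def inner_complex_def sgn_div_norm algebra_simps)
  have "((\<lambda>st. (((1 / 2) *\<^sub>R g'' t0 + e st) \<bullet> unit_normal \<sigma> (g' (snd st))) /
       (norm (g' (snd st) + r st *\<^sub>R ((1 / 2) *\<^sub>R g'' t0 + e st)))\<^sup>2) \<longlongrightarrow>
      (((1 / 2) *\<^sub>R g'' t0 + 0) \<bullet> unit_normal \<sigma> (g' t0)) / (norm (g' t0 + 0 *\<^sub>R ((1 / 2) *\<^sub>R g'' t0 + 0)))\<^sup>2) F"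
    using nz[OF t0] by (intro tendsto_divide q_lim tendsto_power k_lim) simp
  then have lim: "((\<lambda>st. (((1 / 2) *\<^sub>R g'' t0 + e st) \<bullet> unit_normal \<sigma> (g' (snd st))) /
       (norm (g' (snd st) + r st *\<^sub>R ((1 / 2) *\<^sub>R g'' t0 + e st)))\<^sup>2) \<longlongrightarrow>
     (g'' t0 \<bullet> unit_normal \<sigma> (g' t0)) / (norm (g' t0))\<^sup>2 / 2) F"
    by (simp add: mult.commute)
  have ev: "eventually (\<lambda>st. (((1 / 2) *\<^sub>R g'' t0 + e st) \<bullet> unit_normal \<sigma> (g' (snd st))) /
       (norm (g' (snd st) + r st *\<^sub>R ((1 / 2) *\<^sub>R g'' t0 + e st)))\<^sup>2 =
      (case st of (s, t) \<Rightarrow> Re (unit_normal \<sigma> (g' t) / (g s - g t)))) F"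
    using evP
  proof eventually_elim
    case (elim st)
    let ?x = "(1 / 2) *\<^sub>R g'' t0 + e st" and ?\<nu> = "unit_normal \<sigma> (g' (snd st))"
    have "h st \<bullet> ?\<nu> = (r st)\<^sup>2 * (?x \<bullet> ?\<nu>)"
      by (simp only: h_eq[OF elim] inner_add_left inner_scaleR_left orth mult_zero_right add_0)
    moreover have "norm (h st) = \<bar>r st\<bar> * norm (g' (snd st) + r st *\<^sub>R ?x)"
      by (simp add: h_eq[OF elim] power2_eq_square scaleR_add_right flip: norm_scaleR)
    moreover have "g (fst st) - g (snd st) = h st" by (simp add: h_def)
    ultimately show ?case
      using rnz[OF elim] by (simp add: Re_divide_eq_inner case_prod_beta power_mult_distrib)
  qed
  show ?thesis
    using Lim_transform_eventually[OF lim ev] unfolding F_def P_def .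
qed

text \<open>A simple arc is a homeomorphism onto its image, by compactness: points of the arc close to
  \<open>g t0\<close> have parameters close to \<open>t0\<close>.\<close>

lemma arc_inverse_continuous:
  fixes g :: "real \<Rightarrow> 'a::heine_borel"
  assumes g: "continuous_on {0..1} g" "inj_on g {0..1}" and t0: "t0 \<in> {0..1}" and \<delta>: "0 < \<delta>"
  obtains \<rho> where "0 < \<rho>" "\<And>t. t \<in> {0..1} \<Longrightarrow> dist (g t) (g t0) < \<rho> \<Longrightarrow> \<bar>t - t0\<bar> < \<delta>"
proof -
  let ?K = "{0..1} - ball t0 \<delta>"
  have "compact (g ` ?K)"
    by (intro compact_continuous_image continuous_on_subset[OF g(1)] compact_diff) auto
  then have "closed (g ` ?K)" by (rule compact_imp_closed)
  moreover have "g t0 \<notin> g ` ?K"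
    using g(2) t0 \<delta> by (auto dest: inj_onD)
  ultimately obtain \<rho> where \<rho>: "0 < \<rho>" "\<And>x. x \<in> g ` ?K \<Longrightarrow> \<rho> \<le> dist (g t0) x"
    using separate_point_closed[of "g ` ?K" "g t0"] by blast
  have "\<bar>t - t0\<bar> < \<delta>" if "t \<in> {0..1}" "dist (g t) (g t0) < \<rho>" for t
  proof (rule ccontr)
    assume "\<not> \<bar>t - t0\<bar> < \<delta>"
    then have "t \<in> ?K" using that by (auto simp: dist_real_def)
    then show False using \<rho>(2)[of "g t"] that by (auto simp: dist_commute)
  qed
  with \<rho>(1) show thesis by (rule that)
qed

text \<open>Each point of \<open>D\<close> near \<open>a\<close> lies on the inner normal at a nearest boundary point \<open>p\<close>, because
  the distance along the arc is stationary at \<open>p\<close>; the one-sidedness of \<open>D\<close> picks the sign of the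
  normal. The last conjunct says that near \<open>p\<close> the frontier lies between the circles of
  curvature \<open>\<kappa> - 2 \<epsilon>\<close> and \<open>\<kappa> + 2 \<epsilon>\<close> tangent at \<open>p\<close>, in a neighbourhood whose size does not depend
  on \<open>z\<close>.\<close>

lemma local_arc_nearest_point:
  assumes D: "open D" and arc: "local_boundary_arc D a g g' g'' t0 \<sigma>" and \<epsilon>: "0 < \<epsilon>"
  defines "\<kappa> \<equiv> (g'' t0 \<bullet> unit_normal \<sigma> (g' t0)) / (norm (g' t0))\<^sup>2"
  obtains \<rho> where "0 < \<rho>" "\<And>z. z \<in> D \<Longrightarrow> dist z a < \<rho> \<Longrightarrow>
    0 < boundary_dist D z \<and> (\<exists>p n. norm n = 1 \<and> z = p + of_real (boundary_dist D z) * n \<and> p \<notin> D \<and>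
      (\<exists>\<delta>>0. \<forall>s\<in>{0<..<\<delta>}. p - of_real s * n \<notin> D) \<and>
      (\<forall>w\<in>frontier D. w \<noteq> p \<longrightarrow> dist w p < \<rho> \<longrightarrow> \<bar>Re (n / (w - p)) - \<kappa> / 2\<bar> < \<epsilon>))"
proof -
  have C2: "C2_regular_arc g g' g''" and t0: "t0 \<in> {0<..<1}" and a: "g t0 = a" and \<sigma>: "\<sigma> \<in> {1, -1}"
    using arc by (auto simp: local_boundary_arc_def)
  obtain U where U: "open U" "a \<in> U" "frontier D \<inter> U = g ` {0..1} \<inter> U"
    using arc by (auto simp: local_boundary_arc_def)
  obtain \<epsilon>0 where \<epsilon>0: "0 < \<epsilon>0" "\<And>t s. t \<in> {0..1} \<Longrightarrow> \<bar>t - t0\<bar> < \<epsilon>0 \<Longrightarrow> s \<in> {0<..<\<epsilon>0} \<Longrightarrow>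
      g t + of_real s * unit_normal \<sigma> (g' t) \<in> D \<and> g t - of_real s * unit_normal \<sigma> (g' t) \<notin> D"
    using arc unfolding local_boundary_arc_def by blast
  have g: "(g has_vector_derivative g' t) (at t within {0..1})" and nz: "g' t \<noteq> 0" if "t \<in> {0..1}" for t
    using C2 that by (auto simp: C2_regular_arc_def)
  have inj: "inj_on g {0..1}" using C2 by (simp add: C2_regular_arc_def)
  have g_cont: "continuous_on {0..1} g"
    by (meson g continuous_on_eq_continuous_within has_vector_derivative_continuous)
  have t01: "t0 \<in> {0..1}" using t0 by auto
  have a_fr: "a \<in> frontier D" using U(2,3) a t01 by blast
  have "eventually (\<lambda>st. dist (case st of (s, t) \<Rightarrow> Re (unit_normal \<sigma> (g' t) / (g s - g t))) (\<kappa> / 2) < \<epsilon>)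
     (at (t0, t0) within {(s, t). s \<in> {0..1} \<and> t \<in> {0..1} \<and> s \<noteq> t})"
    using tendstoD[OF chord_normal_tendsto[OF C2 t01, of \<sigma>] \<epsilon>] unfolding \<kappa>_def by simp
  then obtain \<delta>1 where \<delta>1: "0 < \<delta>1" "\<And>st. st \<in> {(s, t). s \<in> {0..1} \<and> t \<in> {0..1} \<and> s \<noteq> t} \<Longrightarrow>
      st \<noteq> (t0, t0) \<Longrightarrow> dist st (t0, t0) < \<delta>1 \<Longrightarrow>
      dist (case st of (s, t) \<Rightarrow> Re (unit_normal \<sigma> (g' t) / (g s - g t))) (\<kappa> / 2) < \<epsilon>"
    unfolding eventually_at by blast
  define \<delta> where "\<delta> = Min {\<delta>1 / 2, \<epsilon>0, t0, 1 - t0}"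
  have \<delta>: "0 < \<delta>" "\<delta> \<le> \<delta>1 / 2" "\<delta> \<le> \<epsilon>0" "\<delta> \<le> t0" "\<delta> \<le> 1 - t0"
    using \<delta>1(1) \<epsilon>0(1) t0 by (auto simp: \<delta>_def min_def)
  have chord: "\<bar>Re (unit_normal \<sigma> (g' t) / (g s - g t)) - \<kappa> / 2\<bar> < \<epsilon>"
    if "s \<in> {0..1}" "t \<in> {0..1}" "s \<noteq> t" "\<bar>s - t0\<bar> < \<delta>" "\<bar>t - t0\<bar> < \<delta>" for s t
  proof -
    have "dist (s, t) (t0, t0) \<le> dist s t0 + dist t t0"
      unfolding dist_Pair_Pair by (rule sqrt_sum_squares_le_sum) auto
    also have "\<dots> < \<delta>1" using that \<delta> by (auto simp: dist_real_def)
    finally show ?thesis using \<delta>1(2)[of "(s, t)"] that by (auto simp: dist_real_def)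
  qed
  obtain r where r: "0 < r" "ball a r \<subseteq> U" using U openE by blast
  obtain \<rho>1 where \<rho>1: "0 < \<rho>1" "\<And>t. t \<in> {0..1} \<Longrightarrow> dist (g t) a < \<rho>1 \<Longrightarrow> \<bar>t - t0\<bar> < \<delta>"
    using arc_inverse_continuous[OF g_cont inj t01 \<delta>(1)] unfolding a by metis
  define \<rho> where "\<rho> = Min {r / 3, \<rho>1 / 3, \<epsilon>0}"
  have \<rho>: "0 < \<rho>" "3 * \<rho> \<le> r" "3 * \<rho> \<le> \<rho>1" "\<rho> \<le> \<epsilon>0"
    using r(1) \<rho>1(1) \<epsilon>0(1) by (auto simp: \<rho>_def min_def)
  have param: "\<exists>t\<in>{0..1}. w = g t \<and> \<bar>t - t0\<bar> < \<delta>" if "w \<in> frontier D" "dist w a < 3 * \<rho>" for w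
  proof -
    have "dist a w < r" using that(2) \<rho>(2) by (simp add: dist_commute)
    then have "w \<in> U" using r(2) by auto
    with that(1) have "w \<in> g ` {0..1} \<inter> U" unfolding U(3)[symmetric] by simp
    then obtain t where t: "t \<in> {0..1}" "w = g t" by auto
    moreover have "\<bar>t - t0\<bar> < \<delta>"
      by (rule \<rho>1(2)[OF t(1)]) (use that(2) \<rho>(3) t(2) in simp)
    ultimately show ?thesis by blast
  qed
  have "0 < boundary_dist D z \<and> (\<exists>p n. norm n = 1 \<and> z = p + of_real (boundary_dist D z) * n \<and> p \<notin> D \<and>
      (\<exists>\<delta>>0. \<forall>s\<in>{0<..<\<delta>}. p - of_real s * n \<notin> D) \<and>
      (\<forall>w\<in>frontier D. w \<noteq> p \<longrightarrow> dist w p < \<rho> \<longrightarrow> \<bar>Re (n / (w - p)) - \<kappa> / 2\<bar> < \<epsilon>))"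
    if z: "z \<in> D" "dist z a < \<rho>" for z
  proof -
    define d where "d = boundary_dist D z"
    obtain p where p: "p \<in> frontier D" "d = dist z p"
      unfolding d_def boundary_dist_def using infdist_attains_inf[of "frontier D" z] a_fr by auto
    have d_le: "d \<le> dist z w" if "w \<in> frontier D" for w
      unfolding d_def boundary_dist_def using that by (rule infdist_le)
    have disj: "frontier D \<inter> D = {}" using D frontier_disjoint_eq by blast
    have d0: "0 < d" using p z disj by auto
    have dr: "d < \<rho>" using d_le[OF a_fr] z(2) by simp
    have pa: "dist p a < 2 * \<rho>"
      using dist_triangle[of p a z] p(2) dr z(2) by (simp add: dist_commute)
    obtain t where t: "t \<in> {0..1}" "p = g t" "\<bar>t - t0\<bar> < \<delta>"
      using param[OF p(1)] pa \<rho>(1) by auto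
    have t_int: "t \<in> {0<..<1}" using t(3) \<delta>(4,5) by auto
    have gt: "(g has_vector_derivative g' t) (at t)"
      using g[OF t(1)] t_int at_within_interior[of t "{0..1::real}"] by simp
    \<comment> \<open>The squared distance to \<open>z\<close> has a local minimum along the arc at the interior parameter \<open>t\<close>.\<close>
    have orth: "(g t - z) \<bullet> g' t = 0"
    proof -
      have der: "((\<lambda>s. (g s - z) \<bullet> (g s - z)) has_real_derivative 2 * ((g t - z) \<bullet> g' t)) (at t)"
      proof -
        have "((\<lambda>s. g s - z) has_derivative (\<lambda>h. h *\<^sub>R g' t - 0)) (at t)"
          using gt unfolding has_vector_derivative_def by (intro has_derivative_diff has_derivative_const)
        from has_derivative_inner[OF this this]
        have "((\<lambda>s. (g s - z) \<bullet> (g s - z)) has_derivative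
            (\<lambda>h. (g t - z) \<bullet> (h *\<^sub>R g' t - 0) + (h *\<^sub>R g' t - 0) \<bullet> (g t - z))) (at t)" .
        moreover have "(\<lambda>h. (g t - z) \<bullet> (h *\<^sub>R g' t - 0) + (h *\<^sub>R g' t - 0) \<bullet> (g t - z)) =
            (*) (2 * ((g t - z) \<bullet> g' t))"
          by (rule ext) (simp add: inner_commute)
        ultimately show ?thesis by (simp only: has_field_derivative_def)
      qed
      have "isCont g t" using gt has_vector_derivative_continuous by blast
      then have "eventually (\<lambda>s. dist (g s) (g t) < \<rho>) (at t)"
        using \<rho>(1) by (auto simp: isCont_def dest: tendstoD)
      then obtain \<delta>2 where \<delta>2: "0 < \<delta>2" "\<And>s. s \<noteq> t \<Longrightarrow> dist s t < \<delta>2 \<Longrightarrow> dist (g s) (g t) < \<rho>"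
        unfolding eventually_at by auto
      define \<delta>3 where "\<delta>3 = Min {\<delta>2, t, 1 - t}"
      have \<delta>3: "0 < \<delta>3" "\<delta>3 \<le> \<delta>2" "\<delta>3 \<le> t" "\<delta>3 \<le> 1 - t"
        using \<delta>2(1) t_int by (auto simp: \<delta>3_def min_def)
      have min: "(g t - z) \<bullet> (g t - z) \<le> (g s - z) \<bullet> (g s - z)" if s: "\<bar>t - s\<bar> < \<delta>3" for s
      proof -
        have s01: "s \<in> {0..1}" using s \<delta>3 by auto
        have "dist (g s) p < \<rho>"
          using \<delta>2(2)[of s] s \<delta>3 \<rho>(1) t(2) by (cases "s = t") (auto simp: dist_real_def)
        then have "dist (g s) a < 3 * \<rho>"
          using dist_triangle[of "g s" a p] pa by simp
        then have "dist a (g s) < r" using \<rho>(2) by (simp add: dist_commute)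
        then have "g s \<in> U" using r(2) by auto
        with s01 have "g s \<in> frontier D \<inter> U" unfolding U(3) by simp
        then have "g s \<in> frontier D" by simp
        then have "dist z p \<le> dist z (g s)" using d_le p(2) by simp
        then have "norm (g t - z) \<le> norm (g s - z)" by (simp add: t(2) dist_norm norm_minus_commute)
        then show ?thesis by (simp add: dot_square_norm power_mono)
      qed
      from DERIV_local_min[OF der \<delta>3(1)] min show ?thesis by auto
    qed
    define \<nu> where "\<nu> = unit_normal \<sigma> (g' t)"
    have \<nu>1: "norm \<nu> = 1"
      using nz[OF t(1)] \<sigma> by (auto simp: \<nu>_def unit_normal_def norm_mult norm_sgn)
    have "\<exists>\<mu>. z - p = of_real \<mu> * \<nu>"
    proof -
      let ?u = "sgn (g' t)"
      have u: "?u * cnj ?u = 1"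
        using nz[OF t(1)] by (simp add: complex_norm_square[symmetric] norm_sgn)
      have "Re ((z - p) * cnj ?u) = 0"
        using orth by (simp add: t(2) sgn_div_norm inner_complex_def algebra_simps)
      then obtain l where l: "(z - p) * cnj ?u = \<i> * of_real l"
        by (metis complex_eq add_0 of_real_0)
      have "z - p = (z - p) * (?u * cnj ?u)" by (simp only: u mult_1_right)
      also have "\<dots> = (z - p) * cnj ?u * ?u" by (simp only: ac_simps)
      also have "\<dots> = \<i> * of_real l * ?u" by (simp only: l)
      also have "\<dots> = of_real (\<sigma> * l) * \<nu>"
        using \<sigma> by (auto simp: \<nu>_def unit_normal_def)
      finally have "z - p = of_real (\<sigma> * l) * \<nu>" .
      then show ?thesis by blast
    qed
    then obtain \<mu> where \<mu>: "z - p = of_real \<mu> * \<nu>" by blast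
    have abs\<mu>: "\<bar>\<mu>\<bar> = d"
      using \<nu>1 p(2) \<mu> by (simp add: dist_norm norm_mult)
    have t\<epsilon>: "\<bar>t - t0\<bar> < \<epsilon>0" using t(3) \<delta>(3) by simp
    have outside: "p - of_real s * \<nu> \<notin> D" if "s \<in> {0<..<\<epsilon>0}" for s
      using \<epsilon>0(2)[OF t(1) t\<epsilon> that] by (simp add: t(2) \<nu>_def)
    \<comment> \<open>The other sign would put \<open>z\<close> on the side of the arc that is outside \<open>D\<close>.\<close>
    have "\<mu> = d"
    proof (rule ccontr)
      assume "\<mu> \<noteq> d"
      then have "\<mu> = - d" using abs\<mu> by auto
      then have "z = p - of_real d * \<nu>" using \<mu> by (simp add: algebra_simps)
      then show False using outside[of d] z(1) d0 dr \<rho>(4) by auto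
    qed
    then have zp: "z = p + of_real d * \<nu>" using \<mu> by (simp add: algebra_simps)
    have "\<bar>Re (\<nu> / (w - p)) - \<kappa> / 2\<bar> < \<epsilon>" if w: "w \<in> frontier D" "w \<noteq> p" "dist w p < \<rho>" for w
    proof -
      have "dist w a < 3 * \<rho>" using dist_triangle[of w a p] pa w(3) by simp
      then obtain s where s: "s \<in> {0..1}" "w = g s" "\<bar>s - t0\<bar> < \<delta>" using param w(1) by blast
      then show ?thesis
        using chord[OF s(1) t(1) _ s(3) t(3)] w(2) by (auto simp: \<nu>_def t(2))
    qed
    then show ?thesis
      using d0 \<nu>1 zp p(1) disj outside \<epsilon>0(1) unfolding d_def by blast
  qed
  with \<rho>(1) show thesis by (rule that)
qed

section \<open>Asymptotics of the comparison rates\<close>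

text \<open>The derivative at \<open>p + d n\<close> of the disc-valued map on the complement of the arc.\<close>

definition outer_rate :: "real \<Rightarrow> real \<Rightarrow> real \<Rightarrow> real" where
  "outer_rate R c d = R / (2 * d\<^sup>2 * sqrt (1 + (R * (1 / d - c / 2))\<^sup>2))"

text \<open>The reciprocal of the derivative of the conformal map from the disc onto the lune, centred
  at \<open>p + d n\<close>.\<close>

definition inner_rate :: "real \<Rightarrow> real \<Rightarrow> real \<Rightarrow> real" where
  "inner_rate R c d = R * ((R * (1 / d - c / 2))\<^sup>2 + 1) /
     (2 * d\<^sup>2 * (R * (1 / d - c / 2)) * ((R * (1 / d - c / 2))\<^sup>2 - 1))"

text \<open>Both rates have the expansion \<open>1 / (2 d) + c / 4 + O(d)\<close>: the size parameter \<open>R\<close> first enters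
  in the term of order \<open>d\<close>, so localization to a neighbourhood of fixed size costs nothing in the limit.\<close>

lemma outer_rate_tendsto:
  assumes "0 < R"
  shows "((\<lambda>d. outer_rate R c d - 1 / (2 * d)) \<longlongrightarrow> c / 4) (at_right 0)"
proof -
  consider "c = 0" | "c > 0" | "c < 0" by linarith
  then show ?thesis
    using assms unfolding outer_rate_def by cases real_asymp+
qed

lemma inner_rate_tendsto:
  assumes "0 < R"
  shows "((\<lambda>d. inner_rate R c d - 1 / (2 * d)) \<longlongrightarrow> c / 4) (at_right 0)"
proof -
  define w where "w = (\<lambda>d::real. 1 - c * d / 2)"
  have d: "((\<lambda>d::real. d) \<longlongrightarrow> 0) (at_right 0)" by (simp add: tendsto_ident_at)
  have w: "(w \<longlongrightarrow> 1 - c * 0 / 2) (at_right 0)"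
    unfolding w_def by (intro tendsto_intros d) simp
  have v: "((\<lambda>d. R\<^sup>2 * (w d)\<^sup>2 - d\<^sup>2) \<longlongrightarrow> R\<^sup>2 * (1 - c * 0 / 2)\<^sup>2 - 0\<^sup>2) (at_right 0)"
    by (intro tendsto_intros d w)
  have lim: "((\<lambda>d. (R\<^sup>2 * (w d)\<^sup>2 * (c / 2) + d * (1 + w d)) / (2 * w d * (R\<^sup>2 * (w d)\<^sup>2 - d\<^sup>2))) \<longlongrightarrow>
      (R\<^sup>2 * (1 - c * 0 / 2)\<^sup>2 * (c / 2) + 0 * (1 + (1 - c * 0 / 2))) /
      (2 * (1 - c * 0 / 2) * (R\<^sup>2 * (1 - c * 0 / 2)\<^sup>2 - 0\<^sup>2))) (at_right 0)"
    using assms by (intro tendsto_intros d w) auto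
  have "eventually (\<lambda>d. w d > 0) (at_right 0)" "eventually (\<lambda>d. R\<^sup>2 * (w d)\<^sup>2 - d\<^sup>2 > 0) (at_right 0)"
    using order_tendstoD(1)[OF w, of 0] order_tendstoD(1)[OF v, of 0] assms by auto
  then have "eventually (\<lambda>d. (R\<^sup>2 * (w d)\<^sup>2 * (c / 2) + d * (1 + w d)) / (2 * w d * (R\<^sup>2 * (w d)\<^sup>2 - d\<^sup>2)) =
      inner_rate R c d - 1 / (2 * d)) (at_right 0)"
    using eventually_at_right_less[of "0::real"]
  proof eventually_elim
    case (elim d)
    define V where "V = R\<^sup>2 * (w d)\<^sup>2 - d\<^sup>2"
    have X: "R * (1 / d - c / 2) = R * w d / d"
      using elim by (simp add: w_def field_simps)
    have plus: "(R * w d / d)\<^sup>2 + 1 = (V + 2 * d\<^sup>2) / d\<^sup>2" and minus: "(R * w d / d)\<^sup>2 - 1 = V / d\<^sup>2"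
      using elim by (simp_all add: V_def power_divide power_mult_distrib field_simps)
    have V: "0 < V" using elim by (simp add: V_def)
    have "inner_rate R c d = (V + 2 * d\<^sup>2) / (2 * d * w d * V)"
      unfolding inner_rate_def X plus minus using elim V assms
      by (simp add: field_simps power2_eq_square)
    \<comment> \<open>Clearing denominators cancels the pole \<open>1 / (2 d)\<close> exactly.\<close>
    moreover have "(R\<^sup>2 * (w d)\<^sup>2 * (c / 2) + d * (1 + w d)) / (2 * w d * V) =
        (V + 2 * d\<^sup>2) / (2 * d * w d * V) - 1 / (2 * d)"
    proof -
      have "(V + 2 * d\<^sup>2) / (2 * d * w d * V) - 1 / (2 * d) = (V + 2 * d\<^sup>2 - w d * V) / (2 * d * w d * V)"
        using elim V by (simp add: field_simps)
      also have "V + 2 * d\<^sup>2 - w d * V = d * (R\<^sup>2 * (w d)\<^sup>2 * (c / 2) + d * (1 + w d))"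
        unfolding V_def w_def by (simp add: field_simps power2_eq_square)
      also have "\<dots> / (2 * d * w d * V) = (R\<^sup>2 * (w d)\<^sup>2 * (c / 2) + d * (1 + w d)) / (2 * w d * V)"
        using elim by simp
      finally show ?thesis by simp
    qed
    ultimately show ?case by (simp add: V_def)
  qed
  from Lim_transform_eventually[OF lim this] show ?thesis
    using assms by simp
qed

text \<open>Since \<open>A / B\<close> tends to \<open>1\<close> and \<open>A - B\<close> stays bounded, \<open>A\<^sup>2 / B = A + (A - B) A / B\<close> differs from
  \<open>1 / (2 d)\<close> by a convergent amount.\<close>

lemma square_quotient_tendsto:
  fixes A B :: "real \<Rightarrow> real"
  assumes A: "((\<lambda>d. A d - 1 / (2 * d)) \<longlongrightarrow> \<alpha>) (at_right 0)"
    and B: "((\<lambda>d. B d - 1 / (2 * d)) \<longlongrightarrow> \<beta>) (at_right 0)"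
  shows "((\<lambda>d. (A d)\<^sup>2 / B d - 1 / (2 * d)) \<longlongrightarrow> 2 * \<alpha> - \<beta>) (at_right 0)"
proof -
  define x y where "x = (\<lambda>d. A d - 1 / (2 * d))" and "y = (\<lambda>d. B d - 1 / (2 * d))"
  have d: "((\<lambda>d::real. d) \<longlongrightarrow> 0) (at_right 0)" by (simp add: tendsto_ident_at)
  have "((\<lambda>d. (2 * x d - y d + 2 * d * (x d)\<^sup>2) / (1 + 2 * d * y d)) \<longlongrightarrow>
      (2 * \<alpha> - \<beta> + 2 * 0 * \<alpha>\<^sup>2) / (1 + 2 * 0 * \<beta>)) (at_right 0)"
    using A B d by (intro tendsto_intros) (auto simp: x_def y_def)
  moreover have "eventually (\<lambda>d. 1 + 2 * d * y d > 0) (at_right 0)"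
  proof -
    have "((\<lambda>d. 1 + 2 * d * y d) \<longlongrightarrow> 1 + 2 * 0 * \<beta>) (at_right 0)"
      using B d by (intro tendsto_intros) (auto simp: y_def)
    then show ?thesis by (rule order_tendstoD) simp
  qed
  then have "eventually (\<lambda>d. (2 * x d - y d + 2 * d * (x d)\<^sup>2) / (1 + 2 * d * y d) =
      (A d)\<^sup>2 / B d - 1 / (2 * d)) (at_right 0)"
    using eventually_at_right_less[of "0::real"]
  proof eventually_elim
    case (elim d)
    have Ad: "A d = (1 + 2 * d * x d) / (2 * d)" and Bd: "B d = (1 + 2 * d * y d) / (2 * d)"
      using elim by (auto simp: x_def y_def field_simps)
    define p where "p = 1 + 2 * d * y d"
    have p: "p > 0" "2 * d * y d = p - 1" using elim by (auto simp: p_def)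
    then have yd: "y d = (p - 1) / (2 * d)" using elim by (simp add: field_simps)
    have d: "0 < d" using elim by simp
    show ?case
      unfolding Ad Bd p_def[symmetric] unfolding yd using d p(1)
      by (simp add: field_simps power2_eq_square)
  qed
  ultimately show ?thesis
    using Lim_transform_eventually by fastforce
qed

section \<open>Boundary behaviour of the invariant metrics\<close>

text \<open>Polar coordinates: the set is the image of a product of two intervals.\<close>

lemma connected_left_half_plane_minus_disc:
  "connected {y::complex. Re y \<le> 0 \<and> r \<le> cmod y}" if r: "0 < r"
proof -
  have "{y::complex. Re y \<le> 0 \<and> r \<le> cmod y} =
     (\<lambda>(\<tau>, \<theta>). - rcis \<tau> \<theta>) ` ({r..} \<times> {- (pi / 2)..pi / 2})"
  proof (intro equalityI subsetI)
    fix y :: complex assume y: "y \<in> {y. Re y \<le> 0 \<and> r \<le> cmod y}"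
    then have "\<bar>Arg (- y)\<bar> \<le> pi / 2" by (subst Arg_Re_nonneg) simp
    then have "(cmod (- y), Arg (- y)) \<in> {r..} \<times> {- (pi / 2)..pi / 2}"
      using y by auto
    moreover have "y = (\<lambda>(\<tau>, \<theta>). - rcis \<tau> \<theta>) (cmod (- y), Arg (- y))"
      using rcis_cmod_Arg[of "- y"] by simp
    ultimately show "y \<in> (\<lambda>(\<tau>, \<theta>). - rcis \<tau> \<theta>) ` ({r..} \<times> {- (pi / 2)..pi / 2})"
      by (rule rev_image_eqI)
  qed (use r in \<open>auto intro!: mult_nonneg_nonneg cos_ge_zero\<close>)
  also have "connected \<dots>"
    unfolding rcis_def case_prod_beta
    by (intro connected_continuous_image convex_connected convex_Times continuous_intros) auto
  finally show ?thesis .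
qed

text \<open>The comparison at one point \<open>z\<close>. The frontier near \<open>p\<close> lies strictly between the tangent circles
  of curvature \<open>\<kappa> - 2 \<epsilon>\<close> and \<open>\<kappa> + 2 \<epsilon>\<close>, hence avoids the outer side of the first (except for \<open>p\<close>) and the inner
  side of the second. A connected set that avoids the frontier lies in \<open>D\<close> or is disjoint from it: so \<open>D\<close>
  misses an arc of the first circle, and contains the lune cut from the second.\<close>

lemma metric_between_rates:
  fixes D :: "complex set" and z p n :: complex and \<kappa> \<epsilon> \<rho> R d :: real
  assumes D: "open D" "z \<in> D" and z: "z = p + of_real d * n" and n: "norm n = 1" and p: "p \<notin> D" and d: "0 < d"
    and out: "\<exists>\<delta>>0. \<forall>s\<in>{0<..<\<delta>}. p - of_real s * n \<notin> D"
    and fr: "\<And>w. w \<in> frontier D \<Longrightarrow> w \<noteq> p \<Longrightarrow> dist w p < \<rho> \<Longrightarrow> \<bar>Re (n / (w - p)) - \<kappa> / 2\<bar> < \<epsilon>"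
    and R: "0 < R" "1 / \<rho> + \<bar>\<kappa> / 2\<bar> + \<epsilon> < 1 / R" and \<rho>: "0 < \<rho>" and \<epsilon>: "0 < \<epsilon>"
    and Rd: "1 < R * (1 / d - (\<kappa> + 2 * \<epsilon>) / 2)"
    and m: "m \<in> {caratheodory_metric D, kobayashi_metric D,
              (\<lambda>z. bergman_metric D z / sqrt 2), (\<lambda>z. sqrt (pi * bergman_kernel D z))}"
  defines "A \<equiv> outer_rate R (\<kappa> - 2 * \<epsilon>) d" and "B \<equiv> inner_rate R (\<kappa> + 2 * \<epsilon>) d"
  shows "A\<^sup>2 / B \<le> m z \<and> m z \<le> B\<^sup>2 / A"
proof -
  have n0: "n \<noteq> 0" using n by auto
  \<comment> \<open>The choice of \<open>R\<close> keeps \<open>\<bar>y\<bar> \<ge> 1 / R\<close> within distance \<open>\<rho>\<close> of \<open>p\<close> for both circles.\<close>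
  have far: "y + of_real (c / 2) \<noteq> 0" "dist (p + n / (y + of_real (c / 2))) p < \<rho>"
    "n / (p + n / (y + of_real (c / 2)) - p) = y + of_real (c / 2)"
    "p + n / (y + of_real (c / 2)) \<noteq> p"
    if y: "1 / R \<le> cmod y" and c: "\<bar>c / 2\<bar> \<le> \<bar>\<kappa> / 2\<bar> + \<epsilon>" for y c
  proof -
    have "cmod y \<le> cmod (y + of_real (c / 2)) + \<bar>c / 2\<bar>"
      using norm_triangle_ineq4[of "y + of_real (c / 2)" "of_real (c / 2)"] by (simp only: norm_of_real) simp
    then have big: "1 / \<rho> < cmod (y + of_real (c / 2))" using y c R(2) by linarith
    moreover have "0 < 1 / \<rho>" using \<rho> by simp
    ultimately have pos: "0 < cmod (y + of_real (c / 2))" by linarith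
    then show nz: "y + of_real (c / 2) \<noteq> 0" by auto
    have "1 / cmod (y + of_real (c / 2)) < \<rho>"
      using big pos \<rho> by (simp add: field_simps)
    then show "dist (p + n / (y + of_real (c / 2))) p < \<rho>"
      by (simp add: dist_norm norm_divide n)
    show "n / (p + n / (y + of_real (c / 2)) - p) = y + of_real (c / 2)"
      using nz n0 by simp
    show "p + n / (y + of_real (c / 2)) \<noteq> p" using nz n0 by simp
  qed
  obtain F where F: "F holomorphic_on D" "inj_on F D" "F ` D \<subseteq> ball 0 1" "F z = 0"
    "cmod (deriv F z) = A"
  proof -
    define c where "c = \<kappa> - 2 * \<epsilon>"
    have c: "\<bar>c / 2\<bar> \<le> \<bar>\<kappa> / 2\<bar> + \<epsilon>" using \<epsilon> by (simp add: c_def)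
    define E where "E = {y::complex. Re y \<le> 0 \<and> 1 / R \<le> cmod y}"
    let ?f = "\<lambda>y. p + n / (y + of_real (c / 2))"
    have "connected (?f ` E)"
    proof (rule connected_continuous_image)
      show "continuous_on E ?f"
        using far(1)[OF _ c] by (intro continuous_intros) (auto simp: E_def)
      show "connected E"
        unfolding E_def using R(1) by (intro connected_left_half_plane_minus_disc) simp
    qed
    moreover have "?f ` E \<inter> frontier D = {}"
    proof -
      have "?f y \<notin> frontier D" if "y \<in> E" for y
      proof
        assume *: "?f y \<in> frontier D"
        have y: "1 / R \<le> cmod y" "Re y \<le> 0" using that by (auto simp: E_def)
        have "\<bar>Re (y + of_real (c / 2)) - \<kappa> / 2\<bar> < \<epsilon>"
          using fr[OF * far(4)[OF y(1) c] far(2)[OF y(1) c]] unfolding far(3)[OF y(1) c] .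
        then show False using y(2) by (simp add: c_def field_simps)
      qed
      then show ?thesis by blast
    qed
    moreover have "?f ` E - D \<noteq> {}"
    proof -
      obtain \<delta> where \<delta>: "0 < \<delta>" "\<And>s. s \<in> {0<..<\<delta>} \<Longrightarrow> p - of_real s * n \<notin> D" using out by blast
      \<comment> \<open>A real parameter \<open>- \<tau>\<close> far to the left is a point just outside \<open>D\<close> on the outer normal.\<close>
      define \<tau> where "\<tau> = 1 / R + \<bar>c / 2\<bar> + 1 / \<delta> + 1"
      have "1 / R > 0" "1 / \<delta> > 0" using R(1) \<delta>(1) by auto
      then have "\<tau> - c / 2 > 1 / \<delta>" "\<tau> > 1 / R"
        unfolding \<tau>_def by linarith+
      with \<open>1 / \<delta> > 0\<close> \<open>1 / R > 0\<close> have pos: "0 < \<tau> - c / 2" "0 < \<tau>" by linarith+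
      have s: "1 / (\<tau> - c / 2) \<in> {0<..<\<delta>}"
        using pos(1) \<open>\<tau> - c / 2 > 1 / \<delta>\<close> \<delta>(1)
        by (metis divide_less_eq greaterThanLessThan_iff mult.commute zero_less_divide_1_iff)
      have \<tau>: "- of_real \<tau> \<in> E"
        using pos(2) \<open>\<tau> > 1 / R\<close> by (simp add: E_def)
      have "?f (- of_real \<tau>) = p - of_real (1 / (\<tau> - c / 2)) * n"
      proof -
        obtain X where X: "X = complex_of_real (\<tau> - c / 2)" by simp
        have "- of_real \<tau> + of_real (c / 2) = - X" "of_real (1 / (\<tau> - c / 2)) = 1 / X"
          by (simp_all add: X)
        then show ?thesis by (simp only:) simp
      qed
      then show ?thesis using \<delta>(2)[OF s] \<tau> by (metis (no_types, lifting) DiffI empty_iff imageI)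
    qed
    ultimately have disj: "?f ` E \<inter> D = {}"
      using connected_Int_frontier by blast
    have avoid: "\<not> (Re (n / (w - p) - of_real (c / 2)) = 0 \<and> 1 / R \<le> cmod (n / (w - p) - of_real (c / 2)))"
      if w: "w \<in> D" for w
    proof
      assume *: "Re (n / (w - p) - of_real (c / 2)) = 0 \<and> 1 / R \<le> cmod (n / (w - p) - of_real (c / 2))"
      then have "?f (n / (w - p) - of_real (c / 2)) \<in> ?f ` E" by (intro imageI) (simp add: E_def)
      moreover have "?f (n / (w - p) - of_real (c / 2)) = w" using n0 by simp
      ultimately show False using w disj by auto
    qed
    from outer_arc_map[OF D(1) _ p n d R(1) avoid, folded z, OF D(2)] obtain F where
      "F holomorphic_on D" "inj_on F D" "F ` D \<subseteq> ball 0 1" "F z = 0"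
      "cmod (deriv F z) = R / (2 * d\<^sup>2 * sqrt (1 + (R * (1 / d - c / 2))\<^sup>2))" by metis
    then show thesis by (intro that) (auto simp: A_def outer_rate_def c_def)
  qed
  obtain \<phi> where \<phi>: "\<phi> holomorphic_on ball 0 1" "inj_on \<phi> (ball 0 1)" "\<phi> ` ball 0 1 \<subseteq> D" "\<phi> 0 = z"
    "B = 1 / cmod (deriv \<phi> 0)"
  proof -
    define c where "c = \<kappa> + 2 * \<epsilon>"
    have c: "\<bar>c / 2\<bar> \<le> \<bar>\<kappa> / 2\<bar> + \<epsilon>" using \<epsilon> by (simp add: c_def)
    have Rc: "R * \<bar>c\<bar> < 2"
    proof -
      have "0 < 1 / \<rho>" using \<rho> by simp
      then have "\<bar>c / 2\<bar> < 1 / R" using c R(2) by linarith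
      then show ?thesis using R(1) by (simp add: field_simps)
    qed
    have TD: "T \<subseteq> D" if T: "connected T" "p + of_real d * n \<in> T"
      "T \<subseteq> {p + n / (y + of_real (c / 2)) | y. 0 < Re y \<and> 1 / R < cmod y}" for T
    proof (rule ccontr)
      assume "\<not> T \<subseteq> D"
      then have "T \<inter> frontier D \<noteq> {}"
        using T(1,2) D(2) z by (intro connected_Int_frontier) auto
      then obtain w where w: "w \<in> T" "w \<in> frontier D" by blast
      then obtain y where y: "w = p + n / (y + of_real (c / 2))" "0 < Re y" "1 / R \<le> cmod y"
        using T(3) less_imp_le by blast
      have "\<bar>Re (y + of_real (c / 2)) - \<kappa> / 2\<bar> < \<epsilon>"
        using fr[OF w(2)[unfolded y(1)] far(4)[OF y(3) c] far(2)[OF y(3) c]] unfolding far(3)[OF y(3) c] .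
      then show False using y(2) by (simp add: c_def field_simps)
    qed
    obtain \<phi> where \<phi>: "\<phi> holomorphic_on ball 0 1" "inj_on \<phi> (ball 0 1)" "\<phi> ` ball 0 1 \<subseteq> D"
       "\<phi> 0 = p + of_real d * n"
       "cmod (deriv \<phi> 0) = 2 * d\<^sup>2 * (R * (1 / d - c / 2)) * ((R * (1 / d - c / 2))\<^sup>2 - 1) /
         (R * ((R * (1 / d - c / 2))\<^sup>2 + 1))"
      by (rule inner_lune_map[OF n d R(1) Rc Rd[folded c_def], of p D])
        (erule (2) TD, rule that, assumption+)
    have "B = 1 / cmod (deriv \<phi> 0)"
      unfolding \<phi>(5) by (simp add: B_def inner_rate_def c_def)
    with \<phi>(1-4) show thesis by (intro that) (simp_all add: z)
  qed
  show ?thesis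
    using invariant_metrics_between[OF D F(1-4) \<phi>(1-4) F(5)[symmetric] \<phi>(5) m] .
qed

text \<open>The limit for the curvature of a given parametrization. The independence of the parametrization
  is a consequence.\<close>

lemma invariant_metric_tendsto_arc:
  fixes D :: "complex set" and a :: complex and m :: "complex \<Rightarrow> real"
  assumes D: "open D" and a: "a \<in> frontier D" and arc: "local_boundary_arc D a g g' g'' t0 \<sigma>"
    and m: "m \<in> {caratheodory_metric D, kobayashi_metric D,
              (\<lambda>z. bergman_metric D z / sqrt 2), (\<lambda>z. sqrt (pi * bergman_kernel D z))}"
  defines "\<kappa> \<equiv> (g'' t0 \<bullet> unit_normal \<sigma> (g' t0)) / (norm (g' t0))\<^sup>2"
  shows "((\<lambda>z. m z - 1 / (2 * boundary_dist D z)) \<longlongrightarrow> \<kappa> / 4) (at a within D)"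
proof (rule tendstoI)
  fix e :: real assume e: "0 < e"
  \<comment> \<open>The bounds below tend to \<open>\<kappa> / 4 \<plusminus> 3 \<epsilon> / 2\<close>, and \<open>3 \<epsilon> / 2 < e\<close>.\<close>
  define \<epsilon> where "\<epsilon> = e / 4"
  have \<epsilon>: "0 < \<epsilon>" using e by (simp add: \<epsilon>_def)
  obtain \<rho> where \<rho>: "0 < \<rho>" "\<And>z. z \<in> D \<Longrightarrow> dist z a < \<rho> \<Longrightarrow>
    0 < boundary_dist D z \<and> (\<exists>p n. norm n = 1 \<and> z = p + of_real (boundary_dist D z) * n \<and> p \<notin> D \<and>
      (\<exists>\<delta>>0. \<forall>s\<in>{0<..<\<delta>}. p - of_real s * n \<notin> D) \<and>
      (\<forall>w\<in>frontier D. w \<noteq> p \<longrightarrow> dist w p < \<rho> \<longrightarrow> \<bar>Re (n / (w - p)) - \<kappa> / 2\<bar> < \<epsilon>))"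
    using local_arc_nearest_point[OF D arc \<epsilon>] unfolding \<kappa>_def by metis
  define R where "R = 1 / (1 / \<rho> + \<bar>\<kappa> / 2\<bar> + \<epsilon> + 1)"
  have Rinv: "1 / R = 1 / \<rho> + \<bar>\<kappa> / 2\<bar> + \<epsilon> + 1" by (simp add: R_def)
  have "0 < 1 / \<rho> + \<bar>\<kappa> / 2\<bar> + \<epsilon> + 1" using \<rho>(1) \<epsilon> by (simp add: add_pos_nonneg)
  then have R: "0 < R" by (simp add: R_def)
  let ?A = "outer_rate R (\<kappa> - 2 * \<epsilon>)" and ?B = "inner_rate R (\<kappa> + 2 * \<epsilon>)"
  have lo: "((\<lambda>d. (?A d)\<^sup>2 / ?B d - 1 / (2 * d)) \<longlongrightarrow> 2 * ((\<kappa> - 2 * \<epsilon>) / 4) - (\<kappa> + 2 * \<epsilon>) / 4) (at_right 0)"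
    by (intro square_quotient_tendsto outer_rate_tendsto inner_rate_tendsto R)
  have hi: "((\<lambda>d. (?B d)\<^sup>2 / ?A d - 1 / (2 * d)) \<longlongrightarrow> 2 * ((\<kappa> + 2 * \<epsilon>) / 4) - (\<kappa> - 2 * \<epsilon>) / 4) (at_right 0)"
    by (intro square_quotient_tendsto outer_rate_tendsto inner_rate_tendsto R)
  have "\<kappa> / 4 - e < 2 * ((\<kappa> - 2 * \<epsilon>) / 4) - (\<kappa> + 2 * \<epsilon>) / 4"
       "2 * ((\<kappa> + 2 * \<epsilon>) / 4) - (\<kappa> - 2 * \<epsilon>) / 4 < \<kappa> / 4 + e"
    using e by (simp_all add: \<epsilon>_def field_simps)
  then have ev1: "eventually (\<lambda>d. \<kappa> / 4 - e < (?A d)\<^sup>2 / ?B d - 1 / (2 * d)) (at_right 0)"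
    and ev2: "eventually (\<lambda>d. (?B d)\<^sup>2 / ?A d - 1 / (2 * d) < \<kappa> / 4 + e) (at_right 0)"
    using order_tendstoD(1)[OF lo] order_tendstoD(2)[OF hi] by blast+
  have ev3: "eventually (\<lambda>d. 1 < R * (1 / d - (\<kappa> + 2 * \<epsilon>) / 2)) (at_right 0)"
    using R by real_asymp
  obtain \<delta> where \<delta>: "0 < \<delta>" "\<And>d. 0 < d \<Longrightarrow> d < \<delta> \<Longrightarrow> \<kappa> / 4 - e < (?A d)\<^sup>2 / ?B d - 1 / (2 * d) \<and>
      (?B d)\<^sup>2 / ?A d - 1 / (2 * d) < \<kappa> / 4 + e \<and> 1 < R * (1 / d - (\<kappa> + 2 * \<epsilon>) / 2)"
    using eventually_conj[OF ev1 eventually_conj[OF ev2 ev3]] unfolding eventually_at_right_field by blast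
  have "dist (m z - 1 / (2 * boundary_dist D z)) (\<kappa> / 4) < e"
    if z: "z \<in> D" "dist z a < min \<rho> \<delta>" for z
  proof -
    define d where "d = boundary_dist D z"
    have "dist z a < \<rho>" using z(2) by simp
    from \<rho>(2)[OF z(1) this] obtain p n where d0: "0 < d" and pn: "norm n = 1" "z = p + of_real d * n" "p \<notin> D"
      "\<exists>\<delta>>0. \<forall>s\<in>{0<..<\<delta>}. p - of_real s * n \<notin> D"
      "\<And>w. w \<in> frontier D \<Longrightarrow> w \<noteq> p \<Longrightarrow> dist w p < \<rho> \<Longrightarrow> \<bar>Re (n / (w - p)) - \<kappa> / 2\<bar> < \<epsilon>"
      unfolding d_def[symmetric] by blast
    have "d \<le> dist z a" unfolding d_def boundary_dist_def using a by (rule infdist_le)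
    then have d\<delta>: "d < \<delta>" using z(2) by simp
    have "1 / \<rho> + \<bar>\<kappa> / 2\<bar> + \<epsilon> < 1 / R" unfolding Rinv by simp
    from metric_between_rates[OF D z(1) pn(2,1,3) d0 pn(4,5) R this \<rho>(1) \<epsilon> _ m] \<delta>(2)[OF d0 d\<delta>]
    have "(?A d)\<^sup>2 / ?B d \<le> m z" "m z \<le> (?B d)\<^sup>2 / ?A d" by auto
    then have "\<bar>m z - 1 / (2 * d) - \<kappa> / 4\<bar> < e"
      using \<delta>(2)[OF d0 d\<delta>] by linarith
    then show ?thesis by (simp add: dist_real_def d_def)
  qed
  moreover have "0 < min \<rho> \<delta>" using \<rho>(1) \<delta>(1) by simp
  ultimately show "eventually (\<lambda>z. dist (m z - 1 / (2 * boundary_dist D z)) (\<kappa> / 4) < e) (at a within D)"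
    unfolding eventually_at by blast
qed

theorem proposition1:
  fixes D :: "complex set" and a :: complex and m :: "complex \<Rightarrow> real"
  assumes "open D" and "connected D"
    and "C2_smooth_boundary_point D a"
    and "m \<in> {caratheodory_metric D, kobayashi_metric D,
              (\<lambda>z. bergman_metric D z / sqrt 2), (\<lambda>z. sqrt (pi * bergman_kernel D z))}"
  shows "((\<lambda>z. m z - 1 / (2 * boundary_dist D z)) \<longlongrightarrow> signed_curvature D a / 4) (at a within D)"
proof -
  obtain g g' g'' t0 \<sigma> where a: "a \<in> frontier D" and arc: "local_boundary_arc D a g g' g'' t0 \<sigma>"
    using assms(3) by (auto simp: C2_smooth_boundary_point_def)
  define \<kappa> where "\<kappa> = (g'' t0 \<bullet> unit_normal \<sigma> (g' t0)) / (norm (g' t0))\<^sup>2"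
  have lim: "((\<lambda>z. m z - 1 / (2 * boundary_dist D z)) \<longlongrightarrow> \<kappa> / 4) (at a within D)"
    unfolding \<kappa>_def by (rule invariant_metric_tendsto_arc[OF assms(1) a arc assms(4)])
  have "a \<notin> D" using a assms(1) frontier_disjoint_eq by blast
  then have "a islimpt D" using a by (auto simp: frontier_def closure_def)
  then have nontriv: "at a within D \<noteq> bot" by (simp add: trivial_limit_within)
  \<comment> \<open>All parametrizations yield the same limit, and a limit at a boundary point of \<open>D\<close> is unique.\<close>
  have "signed_curvature D a = \<kappa>"
    unfolding signed_curvature_def
  proof (rule the_equality)
    show "\<exists>g g' g'' t0 \<sigma>. local_boundary_arc D a g g' g'' t0 \<sigma> \<and>
        \<kappa> = (g'' t0 \<bullet> unit_normal \<sigma> (g' t0)) / (norm (g' t0))\<^sup>2"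
      using arc \<kappa>_def by blast
  next
    fix k assume "\<exists>g g' g'' t0 \<sigma>. local_boundary_arc D a g g' g'' t0 \<sigma> \<and>
        k = (g'' t0 \<bullet> unit_normal \<sigma> (g' t0)) / (norm (g' t0))\<^sup>2"
    then have "((\<lambda>z. m z - 1 / (2 * boundary_dist D z)) \<longlongrightarrow> k / 4) (at a within D)"
      using invariant_metric_tendsto_arc[OF assms(1) a _ assms(4)] by blast
    from tendsto_unique[OF nontriv this lim] show "k = \<kappa>" by simp
  qed
  with lim show ?thesis by simp
qed

end
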